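(* Let $\mathcal{M}$ be an $n$-dimensional smooth complete Riemannian manifold, let $f\colon\mathcal{M}\to\mathbb{R}$, $h=(h_1,\dots,h_s)\colon\mathcal{M}\to\mathbb{R}^s$ and $g=(g_1,\dots,g_m)\colon\mathcal{M}\to\mathbb{R}^m$ be continuously differentiable, and let $\Omega=\{q\in\mathcal{M}: h(q)=0,\ g(q)\le 0\}$. Suppose that $p\in\Omega$ satisfies RCPLD. If $p$ is an AKKT point of the problem of minimizing $f$ over $\Omega$, then $p$ is a KKT point of this problem.
   Context: $d$ is the Riemannian distance, $B_\epsilon(p)=\{q\in\mathcal{M}: d(p,q)<\epsilon\}$, and $\operatorname{grad}$ is the Riemannian gradient. For $p\in\Omega$, $\mathcal{A}(p)=\{j\in\{1,\dots,m\}: g_j(p)=0\}$. The Lagrangian is $L(q,\lambda,\mu)=f(q)+\sum_{i=1}^s\lambda_ih_i(q)+\sum_{j=1}^m\mu_jg_j(q)$, and $\operatorname{grad}L$ denotes its gradient with respect to $q$. KKT point: $p\in\Omega$ for which there is $(\lambda,\mu)\in\mathbb{R}^s\times\mathbb{R}^m_+$ with $\operatorname{grad}L(p,\lambda,\mu)=0$ and $\mu_j=0$ for all $j\notin\mathcal{A}(p)$. AKKT point: $p\in\Omega$ for which there are sequences $(p^k)\subset\mathcal{M}$, $(\lambda^k)\subset\mathbb{R}^s$, $(\mu^k)\subset\mathbb{R}^m_+$ such that $p^k\to p$, $\operatorname{grad}L(p^k,\lambda^k,\mu^k)\to0$ (that is, $\|\operatorname{grad}L(p^k,\lambda^k,\mu^k)\|\to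 0$), and $\mu_j^k=0$ for all $j\notin\mathcal{A}(p)$ and all sufficiently large $k$. Families of gradients are regarded as multisets (repetitions allowed). A pair of finite families $(\{v_i\}_{i\in I},\{w_j\}_{j\in J})$ of vectors of $T_p\mathcal{M}$, also written as the union, is positive-linearly dependent if there are $\alpha_i\in\mathbb{R}$ and $\beta_j\ge0$, not all zero, with $\sum_i\alpha_iv_i+\sum_j\beta_jw_j=0$. Below, gradients of $h_i$ play the role of the $v_i$ and gradients of $g_j$ the role of the $w_j$. RCPLD (relaxed constant positive linear dependence): $p\in\Omega$ satisfies RCPLD if there is $\epsilon>0$ such that (a) the rank of $\{\operatorname{grad}h_i(q): i=1,\dots,s\}$ is constant for all $q\in B_\epsilon(p)$; and (b) with $\mathcal{K}\subset\{1,\dots,s\}$ such that $\{\operatorname{grad}h_i(p): i\in\mathcal{K}\}$ is a basis of the subspace generated by $\{\operatorname{grad}h_i(p): i=1,\dots,s\}$ (the condition does not depend on the choice of $\mathcal{K}$), for all $\mathcal{J}\subset\mathcal{A}(p)$, if $\{\operatorname{grad}h_i(p): i\in\mathcal{K}\}\cup\{\operatorname{grad}g_j(p): j\in\mathcal{J}\}$ is positive-linearly dependent, then $\{\operatorname{grad}h_i(q): i\in\mathcal{K}\}\cup\{\operatorname{grad}g_j(q): j\in\mathcal{J}\}$ is linearly dependent for all $q\in B_\epsilon(p)$. *)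

theory Defs
  imports "HOL-Analysis.Analysis" "HOL-Library.Function_Algebras"
begin

section \<open>Vector space structure on functions\<close>

text \<open>
  Tangent vectors are directional derivative operators, i.e. real-valued functions on the
  space of real functions.  The pointwise structure below makes \<open>span\<close> and \<open>dim\<close> available
  for them.
\<close>

instantiation "fun" :: (type, real_vector) real_vector
begin

definition scaleR_fun :: "real \<Rightarrow> ('a \<Rightarrow> 'b) \<Rightarrow> 'a \<Rightarrow> 'b" where
  "scaleR_fun c f = (\<lambda>x. c *\<^sub>R f x)"

instance
  by standard (simp_all add: scaleR_fun_def plus_fun_def algebra_simps)

end

section \<open>Smooth manifolds\<close>

text \<open>
  On an open set \<open>S\<close> of a Euclidean space, \<open>Ck_on k f S\<close> says that \<open>f\<close> is \<open>k\<close> times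
  continuously differentiable: all directional derivatives of the first derivative are
  \<open>k - 1\<close> times continuously differentiable.
\<close>

primrec Ck_on :: "nat \<Rightarrow> ('a::real_normed_vector \<Rightarrow> 'b::real_normed_vector) \<Rightarrow> 'a set \<Rightarrow> bool" where
  "Ck_on 0 f S \<longleftrightarrow> continuous_on S f"
| "Ck_on (Suc k) f S \<longleftrightarrow>
     (\<forall>x\<in>S. f differentiable (at x)) \<and> (\<forall>v. Ck_on k (\<lambda>x. frechet_derivative f (at x) v) S)"

definition smooth_on :: "'a::real_normed_vector set \<Rightarrow> ('a \<Rightarrow> 'b::real_normed_vector) \<Rightarrow> bool" where
  "smooth_on S f \<longleftrightarrow> (\<forall>k. Ck_on k f S)"

text \<open>
  A chart is a pair of a domain \<open>U\<close> and a map defined on \<open>U\<close>; the values of the map outside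
  \<open>U\<close> are irrelevant.
\<close>

type_synonym ('a, 'n) chart = "'a set \<times> ('a \<Rightarrow> real ^ 'n)"

abbreviation chart_inv :: "('a, 'n) chart \<Rightarrow> real ^ 'n \<Rightarrow> 'a" where
  "chart_inv c \<equiv> inv_into (fst c) (snd c)"

abbreviation chart_img :: "('a, 'n) chart \<Rightarrow> (real ^ 'n) set" where
  "chart_img c \<equiv> snd c ` fst c"

text \<open>
  The manifold is the whole type \<open>'a\<close>, Hausdorff and second countable, of dimension
  \<open>CARD('n)\<close>.  The atlas need not be maximal; it determines the smooth structure.
\<close>

definition smooth_atlas ::
  "('a::{t2_space, second_countable_topology}, 'n::finite) chart set \<Rightarrow> bool" where
  "smooth_atlas A \<longleftrightarrow>
     (\<Union>c\<in>A. fst c) = UNIV \<and>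
     (\<forall>c\<in>A. open (fst c) \<and> open (chart_img c) \<and>
        homeomorphism (fst c) (chart_img c) (snd c) (chart_inv c)) \<and>
     (\<forall>c\<in>A. \<forall>c'\<in>A. smooth_on (snd c ` (fst c \<inter> fst c')) (snd c' \<circ> chart_inv c))"

definition C1_fun :: "('a::topological_space, 'n::finite) chart set \<Rightarrow> ('a \<Rightarrow> real) \<Rightarrow> bool" where
  "C1_fun A f \<longleftrightarrow> (\<forall>c\<in>A. Ck_on 1 (f \<circ> chart_inv c) (chart_img c))"

definition differentiable_at_pt ::
  "('a, 'n::finite) chart set \<Rightarrow> 'a \<Rightarrow> ('a \<Rightarrow> real) \<Rightarrow> bool" where
  "differentiable_at_pt A p f \<longleftrightarrow>
     (\<exists>c\<in>A. p \<in> fst c \<and> (f \<circ> chart_inv c) differentiable (at (snd c p)))"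

text \<open>
  The tangent vector at \<open>p\<close> with coordinates \<open>v\<close> in the chart \<open>c\<close> acts on a function \<open>f\<close>
  as the derivative at \<open>snd c p\<close>, in direction \<open>v\<close>, of \<open>f\<close> read in the chart.  It is set to \<open>0\<close> on functions that are not
  differentiable at \<open>p\<close>, so that it does not depend on the chart used to represent it.
\<close>

definition coord_vector ::
  "('a, 'n::finite) chart set \<Rightarrow> ('a, 'n) chart \<Rightarrow> 'a \<Rightarrow> real ^ 'n \<Rightarrow> ('a \<Rightarrow> real) \<Rightarrow> real" where
  "coord_vector A c p v =
     (\<lambda>f. if differentiable_at_pt A p f
          then frechet_derivative (f \<circ> chart_inv c) (at (snd c p)) v else 0)"

definition tangent_space ::
  "('a, 'n::finite) chart set \<Rightarrow> 'a \<Rightarrow> (('a \<Rightarrow> real) \<Rightarrow> real) set" where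
  "tangent_space A p = {coord_vector A c p v | c v. c \<in> A \<and> p \<in> fst c}"

section \<open>Riemannian manifolds\<close>

text \<open>Bilinearity follows from symmetry and linearity in the first argument.\<close>

definition riemannian_metric ::
  "('a, 'n::finite) chart set \<Rightarrow>
   ('a \<Rightarrow> (('a \<Rightarrow> real) \<Rightarrow> real) \<Rightarrow> (('a \<Rightarrow> real) \<Rightarrow> real) \<Rightarrow> real) \<Rightarrow> bool" where
  "riemannian_metric A G \<longleftrightarrow>
     (\<forall>p. \<forall>X\<in>tangent_space A p. \<forall>Y\<in>tangent_space A p. G p X Y = G p Y X) \<and>
     (\<forall>p. \<forall>X\<in>tangent_space A p. \<forall>Y\<in>tangent_space A p. \<forall>Z\<in>tangent_space A p. \<forall>a b.
        G p (a *\<^sub>R X + b *\<^sub>R Y) Z = a * G p X Z + b * G p Y Z) \<and>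
     (\<forall>p. \<forall>X\<in>tangent_space A p. X \<noteq> 0 \<longrightarrow> 0 < G p X X) \<and>
     (\<forall>c\<in>A. \<forall>v w. smooth_on (chart_img c)
        (\<lambda>x. G (chart_inv c x)
               (coord_vector A c (chart_inv c x) v) (coord_vector A c (chart_inv c x) w)))"

definition tangent_norm ::
  "('a \<Rightarrow> (('a \<Rightarrow> real) \<Rightarrow> real) \<Rightarrow> (('a \<Rightarrow> real) \<Rightarrow> real) \<Rightarrow> real) \<Rightarrow>
   'a \<Rightarrow> (('a \<Rightarrow> real) \<Rightarrow> real) \<Rightarrow> real" where
  "tangent_norm G p X = sqrt (G p X X)"

text \<open>\<open>V f\<close> is the differential of \<open>f\<close> at \<open>p\<close> applied to the tangent vector \<open>V\<close>.\<close>

definition rgrad ::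
  "('a, 'n::finite) chart set \<Rightarrow>
   ('a \<Rightarrow> (('a \<Rightarrow> real) \<Rightarrow> real) \<Rightarrow> (('a \<Rightarrow> real) \<Rightarrow> real) \<Rightarrow> real) \<Rightarrow>
   ('a \<Rightarrow> real) \<Rightarrow> 'a \<Rightarrow> ('a \<Rightarrow> real) \<Rightarrow> real" where
  "rgrad A G f p =
     (THE X. X \<in> tangent_space A p \<and> (\<forall>V\<in>tangent_space A p. G p X V = V f))"

definition C1_curve_on ::
  "('a::topological_space, 'n::finite) chart set \<Rightarrow> (real \<Rightarrow> 'a) \<Rightarrow> real \<Rightarrow> real \<Rightarrow> bool" where
  "C1_curve_on A \<gamma> a b \<longleftrightarrow>
     continuous_on {a..b} \<gamma> \<and>
     (\<forall>c\<in>A. \<exists>D. continuous_on ({a..b} \<inter> \<gamma> -` fst c) D \<and>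
        (\<forall>t\<in>{a..b} \<inter> \<gamma> -` fst c.
           ((snd c \<circ> \<gamma>) has_vector_derivative D t) (at t within {a..b})))"

text \<open>
  Piecewise C1 curves on \<open>[0,1]\<close>: \<open>T\<close> is the set of points of a subdivision, and
  \<open>{a<..<b} \<inter> T = {}\<close> says that \<open>a\<close> and \<open>b\<close> are consecutive.
\<close>

definition piecewise_C1_curve ::
  "('a::topological_space, 'n::finite) chart set \<Rightarrow> (real \<Rightarrow> 'a) \<Rightarrow> bool" where
  "piecewise_C1_curve A \<gamma> \<longleftrightarrow>
     (\<exists>T. finite T \<and> {0, 1} \<subseteq> T \<and> T \<subseteq> {0..1} \<and>
        (\<forall>a\<in>T. \<forall>b\<in>T. a < b \<and> {a<..<b} \<inter> T = {} \<longrightarrow> C1_curve_on A \<gamma> a b))"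

definition velocity ::
  "('a, 'n::finite) chart set \<Rightarrow> (real \<Rightarrow> 'a) \<Rightarrow> real \<Rightarrow> ('a \<Rightarrow> real) \<Rightarrow> real" where
  "velocity A \<gamma> t =
     (\<lambda>f. if differentiable_at_pt A (\<gamma> t) f
          then vector_derivative (f \<circ> \<gamma>) (at t within {0..1}) else 0)"

text \<open>The velocity is unspecified at the finitely many break points, a null set.\<close>

definition curve_length ::
  "('a, 'n::finite) chart set \<Rightarrow>
   ('a \<Rightarrow> (('a \<Rightarrow> real) \<Rightarrow> real) \<Rightarrow> (('a \<Rightarrow> real) \<Rightarrow> real) \<Rightarrow> real) \<Rightarrow>
   (real \<Rightarrow> 'a) \<Rightarrow> ennreal" where
  "curve_length A G \<gamma> =
     (\<integral>\<^sup>+t\<in>{0..1}. ennreal (tangent_norm G (\<gamma> t) (velocity A \<gamma> t)) \<partial>lborel)"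

text \<open>
  The distance is infinite between points in different connected components, so that
  connectedness need not be assumed.
\<close>

definition rdist ::
  "('a::topological_space, 'n::finite) chart set \<Rightarrow>
   ('a \<Rightarrow> (('a \<Rightarrow> real) \<Rightarrow> real) \<Rightarrow> (('a \<Rightarrow> real) \<Rightarrow> real) \<Rightarrow> real) \<Rightarrow>
   'a \<Rightarrow> 'a \<Rightarrow> ennreal" where
  "rdist A G p q =
     (INF \<gamma>\<in>{\<gamma>. piecewise_C1_curve A \<gamma> \<and> \<gamma> 0 = p \<and> \<gamma> 1 = q}. curve_length A G \<gamma>)"

definition rball ::
  "('a::topological_space, 'n::finite) chart set \<Rightarrow>
   ('a \<Rightarrow> (('a \<Rightarrow> real) \<Rightarrow> real) \<Rightarrow> (('a \<Rightarrow> real) \<Rightarrow> real) \<Rightarrow> real) \<Rightarrow>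
   'a \<Rightarrow> real \<Rightarrow> 'a set" where
  "rball A G p \<epsilon> = {q. rdist A G p q < ennreal \<epsilon>}"

definition riemannian_complete ::
  "('a::topological_space, 'n::finite) chart set \<Rightarrow>
   ('a \<Rightarrow> (('a \<Rightarrow> real) \<Rightarrow> real) \<Rightarrow> (('a \<Rightarrow> real) \<Rightarrow> real) \<Rightarrow> real) \<Rightarrow> bool" where
  "riemannian_complete A G \<longleftrightarrow>
     (\<forall>P :: nat \<Rightarrow> 'a.
        (\<forall>\<epsilon>>0. \<exists>N. \<forall>k\<ge>N. \<forall>l\<ge>N. rdist A G (P k) (P l) < ennreal \<epsilon>) \<longrightarrow>
        (\<exists>q. (\<lambda>k. rdist A G (P k) q) \<longlonglongrightarrow> 0))"

section \<open>Constrained optimization\<close>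

text \<open>The constraints are \<open>h i\<close> for \<open>i \<in> {1..s}\<close> and \<open>g j\<close> for \<open>j \<in> {1..m}\<close>.\<close>

definition feasible ::
  "nat \<Rightarrow> (nat \<Rightarrow> 'a \<Rightarrow> real) \<Rightarrow> nat \<Rightarrow> (nat \<Rightarrow> 'a \<Rightarrow> real) \<Rightarrow> 'a set" where
  "feasible s h m g = {q. (\<forall>i\<in>{1..s}. h i q = 0) \<and> (\<forall>j\<in>{1..m}. g j q \<le> 0)}"

definition active :: "nat \<Rightarrow> (nat \<Rightarrow> 'a \<Rightarrow> real) \<Rightarrow> 'a \<Rightarrow> nat set" where
  "active m g p = {j\<in>{1..m}. g j p = 0}"

definition lagrangian ::
  "('a \<Rightarrow> real) \<Rightarrow> nat \<Rightarrow> (nat \<Rightarrow> 'a \<Rightarrow> real) \<Rightarrow> nat \<Rightarrow> (nat \<Rightarrow> 'a \<Rightarrow> real) \<Rightarrow>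
   'a \<Rightarrow> (nat \<Rightarrow> real) \<Rightarrow> (nat \<Rightarrow> real) \<Rightarrow> real" where
  "lagrangian f s h m g q lam \<mu> =
     f q + (\<Sum>i\<in>{1..s}. lam i * h i q) + (\<Sum>j\<in>{1..m}. \<mu> j * g j q)"

definition KKT_point ::
  "('a, 'n::finite) chart set \<Rightarrow>
   ('a \<Rightarrow> (('a \<Rightarrow> real) \<Rightarrow> real) \<Rightarrow> (('a \<Rightarrow> real) \<Rightarrow> real) \<Rightarrow> real) \<Rightarrow>
   ('a \<Rightarrow> real) \<Rightarrow> nat \<Rightarrow> (nat \<Rightarrow> 'a \<Rightarrow> real) \<Rightarrow> nat \<Rightarrow> (nat \<Rightarrow> 'a \<Rightarrow> real) \<Rightarrow> 'a \<Rightarrow> bool" where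
  "KKT_point A G f s h m g p \<longleftrightarrow>
     p \<in> feasible s h m g \<and>
     (\<exists>lam \<mu>. (\<forall>j\<in>{1..m}. 0 \<le> \<mu> j) \<and>
        rgrad A G (\<lambda>q. lagrangian f s h m g q lam \<mu>) p = 0 \<and>
        (\<forall>j\<in>{1..m} - active m g p. \<mu> j = 0))"

definition AKKT_point ::
  "('a::topological_space, 'n::finite) chart set \<Rightarrow>
   ('a \<Rightarrow> (('a \<Rightarrow> real) \<Rightarrow> real) \<Rightarrow> (('a \<Rightarrow> real) \<Rightarrow> real) \<Rightarrow> real) \<Rightarrow>
   ('a \<Rightarrow> real) \<Rightarrow> nat \<Rightarrow> (nat \<Rightarrow> 'a \<Rightarrow> real) \<Rightarrow> nat \<Rightarrow> (nat \<Rightarrow> 'a \<Rightarrow> real) \<Rightarrow> 'a \<Rightarrow> bool" where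
  "AKKT_point A G f s h m g p \<longleftrightarrow>
     p \<in> feasible s h m g \<and>
     (\<exists>P lam \<mu>. (\<forall>k. \<forall>j\<in>{1..m}. 0 \<le> \<mu> k j) \<and>
        P \<longlonglongrightarrow> p \<and>
        (\<lambda>k. tangent_norm G (P k)
               (rgrad A G (\<lambda>q. lagrangian f s h m g q (lam k) (\<mu> k)) (P k))) \<longlonglongrightarrow> 0 \<and>
        (\<forall>\<^sub>F k in sequentially. \<forall>j\<in>{1..m} - active m g p. \<mu> k j = 0))"

text \<open>
  Linear (in)dependence of indexed families, in which repeated vectors count with
  multiplicity; the notions of the library for sets would identify them.
\<close>

definition lin_dep :: "'i set \<Rightarrow> ('i \<Rightarrow> 'v::real_vector) \<Rightarrow> 'j set \<Rightarrow> ('j \<Rightarrow> 'v) \<Rightarrow> bool" where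
  "lin_dep I v J w \<longleftrightarrow>
     (\<exists>\<alpha> \<beta>. ((\<exists>i\<in>I. \<alpha> i \<noteq> 0) \<or> (\<exists>j\<in>J. \<beta> j \<noteq> 0)) \<and>
        (\<Sum>i\<in>I. \<alpha> i *\<^sub>R v i) + (\<Sum>j\<in>J. \<beta> j *\<^sub>R w j) = 0)"

definition pos_lin_dep :: "'i set \<Rightarrow> ('i \<Rightarrow> 'v::real_vector) \<Rightarrow> 'j set \<Rightarrow> ('j \<Rightarrow> 'v) \<Rightarrow> bool" where
  "pos_lin_dep I v J w \<longleftrightarrow>
     (\<exists>\<alpha> \<beta>. (\<forall>j\<in>J. 0 \<le> \<beta> j) \<and> ((\<exists>i\<in>I. \<alpha> i \<noteq> 0) \<or> (\<exists>j\<in>J. \<beta> j \<noteq> 0)) \<and>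
        (\<Sum>i\<in>I. \<alpha> i *\<^sub>R v i) + (\<Sum>j\<in>J. \<beta> j *\<^sub>R w j) = 0)"

definition family_basis_of :: "'i set \<Rightarrow> ('i \<Rightarrow> 'v::real_vector) \<Rightarrow> 'v set \<Rightarrow> bool" where
  "family_basis_of K v S \<longleftrightarrow> inj_on v K \<and> independent (v ` K) \<and> span (v ` K) = S"

text \<open>
  The index set \<open>K\<close> is quantified existentially: up to shrinking \<open>\<epsilon>\<close>, the
  condition is independent of its choice, and this is the least demanding form.
\<close>

definition RCPLD ::
  "('a::topological_space, 'n::finite) chart set \<Rightarrow>
   ('a \<Rightarrow> (('a \<Rightarrow> real) \<Rightarrow> real) \<Rightarrow> (('a \<Rightarrow> real) \<Rightarrow> real) \<Rightarrow> real) \<Rightarrow>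
   nat \<Rightarrow> (nat \<Rightarrow> 'a \<Rightarrow> real) \<Rightarrow> nat \<Rightarrow> (nat \<Rightarrow> 'a \<Rightarrow> real) \<Rightarrow> 'a \<Rightarrow> bool" where
  "RCPLD A G s h m g p \<longleftrightarrow>
     p \<in> feasible s h m g \<and>
     (\<exists>\<epsilon>>0.
        (\<exists>r. \<forall>q\<in>rball A G p \<epsilon>. dim ((\<lambda>i. rgrad A G (h i) q) ` {1..s}) = r) \<and>
        (\<exists>K\<subseteq>{1..s}.
           family_basis_of K (\<lambda>i. rgrad A G (h i) p) (span ((\<lambda>i. rgrad A G (h i) p) ` {1..s})) \<and>
           (\<forall>J\<subseteq>active m g p.
              pos_lin_dep K (\<lambda>i. rgrad A G (h i) p) J (\<lambda>j. rgrad A G (g j) p) \<longrightarrow>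
              (\<forall>q\<in>rball A G p \<epsilon>.
                 lin_dep K (\<lambda>i. rgrad A G (h i) q) J (\<lambda>j. rgrad A G (g j) q)))))"

end

theory Submission
  imports Defs
begin

text \<open>
  An approximate KKT sequence comes with multipliers that may be unbounded, so one cannot pass to
  the limit directly. RCPLD repairs this. Near \<open>p\<close> the gradients of the \<open>h i\<close> with \<open>i \<in> K\<close> remain
  independent and, the rank being constant, they span all gradients of equality constraints; hence
  multipliers outside \<open>K\<close> can be set to zero (\<open>subfamily_spans\<close>, \<open>eventually_lin_indep\<close>). By
  Caratheodory's lemma (\<open>caratheodory_multipliers\<close>) the inequality multipliers can be moved to a
  set \<open>J\<close> of active indices along which the gradients are linearly independent; on a subsequence
  \<open>J\<close> does not change. Since independence occurs at points arbitrarily close to \<open>p\<close>, RCPLD forbids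
  the gradients belonging to \<open>K\<close> and \<open>J\<close> from being positive-linearly dependent at \<open>p\<close>. If the multipliers
  were unbounded, dividing by their size would produce such a dependence in the limit; so they are
  bounded, and a limit point of them is a KKT multiplier. The proposition
  \<open>multipliers_in_the_limit\<close> carries this out for vectors in a normed space.

  What remains is to bring the manifold into this form. In a chart around \<open>p\<close>, the Riemannian
  gradient at \<open>q\<close> is the image of the vector of partial derivatives under an injective linear map
  that depends on \<open>q\<close> only (\<open>rgrad_linear_image\<close>). Hence dependence, positive-linear dependence
  and rank can be read off the partial derivatives, which are continuous in \<open>q\<close> and live in
  one fixed Euclidean space. Two estimates link the metric with the chart, and both follow from a
  local upper bound for the metric tensor (\<open>tangent_norm_le\<close>): Lagrangian gradients that tend to
  zero in the Riemannian norm do so in coordinates (\<open>norm_chart_grad_le\<close>), and a sequence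
  converging to \<open>p\<close> eventually lies in each Riemannian ball around \<open>p\<close> (\<open>eventually_in_rball\<close>).
\<close>

section \<open>Dependent families and Caratheodory's lemma\<close>

lemma lin_dep_linear_image:
  assumes \<Phi>: "linear \<Phi>" "inj \<Phi>"
    and v: "\<And>i. i \<in> I \<Longrightarrow> v' i = \<Phi> (v i)" and w: "\<And>j. j \<in> J \<Longrightarrow> w' j = \<Phi> (w j)"
  shows "lin_dep I v' J w' \<longleftrightarrow> lin_dep I v J w"
    and "pos_lin_dep I v' J w' \<longleftrightarrow> pos_lin_dep I v J w"
proof -
  have "(\<Sum>i\<in>I. \<alpha> i *\<^sub>R v' i) + (\<Sum>j\<in>J. \<beta> j *\<^sub>R w' j) =
      \<Phi> ((\<Sum>i\<in>I. \<alpha> i *\<^sub>R v i) + (\<Sum>j\<in>J. \<beta> j *\<^sub>R w j))" for \<alpha> \<beta>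
    by (simp add: linear_add[OF \<Phi>(1)] linear_sum[OF \<Phi>(1)] linear_scale[OF \<Phi>(1)] v w)
  moreover have "\<Phi> x = 0 \<longleftrightarrow> x = 0" for x
    using linear_injective_0[OF \<Phi>(1)] linear_0[OF \<Phi>(1)] \<Phi>(2) by blast
  ultimately have "(\<Sum>i\<in>I. \<alpha> i *\<^sub>R v' i) + (\<Sum>j\<in>J. \<beta> j *\<^sub>R w' j) = 0 \<longleftrightarrow>
      (\<Sum>i\<in>I. \<alpha> i *\<^sub>R v i) + (\<Sum>j\<in>J. \<beta> j *\<^sub>R w j) = 0" for \<alpha> \<beta>
    by metis
  then show "lin_dep I v' J w' \<longleftrightarrow> lin_dep I v J w"
    "pos_lin_dep I v' J w' \<longleftrightarrow> pos_lin_dep I v J w"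
    by (simp_all add: lin_dep_def pos_lin_dep_def)
qed

text \<open>
  Constraint qualifications speak of indexed families, the library of sets; for a family without
  sign-constrained members the two notions of independence agree once the family is injective.
\<close>

lemma not_lin_dep_iff_independent:
  fixes v :: "'i \<Rightarrow> 'v::real_vector" and w :: "'j \<Rightarrow> 'v"
  assumes K: "finite K"
  shows "\<not> lin_dep K v {} w \<longleftrightarrow> inj_on v K \<and> independent (v ` K)"
proof (intro iffI conjI)
  assume ind: "\<not> lin_dep K v {} w"
  then have zero: "\<forall>i\<in>K. \<alpha> i = 0" if "(\<Sum>i\<in>K. \<alpha> i *\<^sub>R v i) = 0" for \<alpha> :: "'i \<Rightarrow> real"
    using that by (auto simp: lin_dep_def)
  show inj: "inj_on v K"
  proof (rule inj_onI, rule ccontr)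
    fix i j assume ij: "i \<in> K" "j \<in> K" "v i = v j" "i \<noteq> j"
    define \<alpha> :: "'i \<Rightarrow> real" where "\<alpha> l = (if l = i then 1 else if l = j then - 1 else 0)" for l
    have "(\<Sum>l\<in>K. \<alpha> l *\<^sub>R v l) = (\<Sum>l\<in>{i, j}. \<alpha> l *\<^sub>R v l)"
      using K ij by (intro sum.mono_neutral_right) (auto simp: \<alpha>_def)
    also have "\<dots> = 0" using ij by (simp add: \<alpha>_def)
    finally have "\<alpha> i = 0" using zero ij by blast
    then show False by (simp add: \<alpha>_def)
  qed
  show "independent (v ` K)"
  proof
    assume "dependent (v ` K)"
    then obtain u where u: "\<exists>x\<in>v ` K. u x \<noteq> 0" "(\<Sum>x\<in>v ` K. u x *\<^sub>R x) = 0"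
      using K by (auto simp: dependent_finite)
    then show False using zero[of "u \<circ> v"] by (auto simp: sum.reindex[OF inj] o_def)
  qed
next
  assume ind: "inj_on v K \<and> independent (v ` K)"
  show "\<not> lin_dep K v {} w"
  proof
    assume "lin_dep K v {} w"
    then obtain \<alpha> :: "'i \<Rightarrow> real" and i where a: "i \<in> K" "\<alpha> i \<noteq> 0" "(\<Sum>i\<in>K. \<alpha> i *\<^sub>R v i) = 0"
      by (auto simp: lin_dep_def)
    define u where "u x = \<alpha> (inv_into K v x)" for x
    have uv: "u (v l) = \<alpha> l" if "l \<in> K" for l using ind that by (simp add: u_def)
    have "(\<Sum>x\<in>v ` K. u x *\<^sub>R x) = (\<Sum>i\<in>K. \<alpha> i *\<^sub>R v i)"
      using ind by (auto simp: sum.reindex uv intro!: sum.cong)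
    then have "dependent (v ` K)"
      using K a uv by (auto simp: dependent_finite intro!: exI[of _ u])
    then show False using ind by blast
  qed
qed

text \<open>
  This is how the constant rank hypothesis enters: an independent subfamily whose size is the
  rank cannot be enlarged to a bigger independent one. The vector space may be infinite
  dimensional, as the space that carries the tangent vectors is.
\<close>

lemma subfamily_spans:
  fixes v :: "'i \<Rightarrow> 'v::real_vector" and w :: "'j \<Rightarrow> 'v"
  assumes I: "finite I" and K: "K \<subseteq> I" and ind: "\<not> lin_dep K v {} w"
    and rank: "dim (v ` I) = card K" and i: "i \<in> I"
  shows "v i \<in> span (v ` K)"
proof -
  have fin: "finite K" using I K finite_subset by blast
  have inj: "inj_on v K" and indK: "independent (v ` K)"
    using ind by (simp_all add: not_lin_dep_iff_independent[OF fin])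
  obtain B where B: "v ` K \<subseteq> B" "B \<subseteq> v ` I" "independent B" "v ` I \<subseteq> span B"
    using maximal_independent_subset_extend[of "v ` K" "v ` I"] K indK by blast
  have "card B = dim (v ` I)" by (rule basis_card_eq_dim[OF B(2,4,3)])
  also have "\<dots> = card (v ` K)" using rank inj by (simp add: card_image)
  finally have "v ` K = B"
    using B I by (metis card_subset_eq finite_imageI finite_subset)
  then show ?thesis using B i by blast
qed

lemma span_family:
  fixes v :: "'i \<Rightarrow> 'v::real_vector"
  assumes K: "finite K" and x: "x \<in> span (v ` K)"
  shows "\<exists>\<alpha>. x = (\<Sum>i\<in>K. \<alpha> i *\<^sub>R v i)"
  using x
proof (induction rule: span_induct_alt)
  case base
  show ?case by (rule exI[of _ "\<lambda>_. 0"]) simp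
next
  case (step c x y)
  then obtain i \<alpha> where i: "i \<in> K" "x = v i" "y = (\<Sum>i\<in>K. \<alpha> i *\<^sub>R v i)" by blast
  have "c *\<^sub>R v i = (\<Sum>l\<in>K. (if l = i then c else 0) *\<^sub>R v l)"
    using K i by (simp add: if_distrib[of "\<lambda>z. z *\<^sub>R _"] cong: if_cong)
  then have "c *\<^sub>R x + y = (\<Sum>l\<in>K. ((if l = i then c else 0) + \<alpha> l) *\<^sub>R v l)"
    using i by (simp add: scaleR_left_distrib sum.distrib)
  then show ?case by (rule exI[of _ "\<lambda>l. (if l = i then c else 0) + \<alpha> l"])
qed

text \<open>
  Caratheodory's lemma for cones, relative to a family \<open>v\<close> with free coefficients that is kept
  whole. As long as the family is dependent, a multiple of the dependence relation can be
  subtracted until the first of the sign-constrained coefficients vanishes; that index is dropped. Some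
  \<open>w j\<close> always takes part in the relation because \<open>v\<close> by itself is independent.
\<close>

lemma caratheodory_multipliers:
  fixes v :: "'i \<Rightarrow> 'v::real_vector" and w :: "'j \<Rightarrow> 'v"
  assumes K: "finite K" and ind: "\<not> lin_dep K v {} w"
    and J0: "finite J0" and nonneg: "\<forall>j\<in>J0. 0 \<le> \<beta>0 j"
  shows "\<exists>J\<subseteq>J0. \<exists>\<alpha> \<beta>. (\<forall>j\<in>J. 0 \<le> \<beta> j) \<and> \<not> lin_dep K v J w \<and>
    (\<Sum>i\<in>K. \<alpha>0 i *\<^sub>R v i) + (\<Sum>j\<in>J0. \<beta>0 j *\<^sub>R w j) =
    (\<Sum>i\<in>K. \<alpha> i *\<^sub>R v i) + (\<Sum>j\<in>J. \<beta> j *\<^sub>R w j)"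
  using J0 nonneg
proof (induction "card J0" arbitrary: J0 \<alpha>0 \<beta>0 rule: less_induct)
  case less
  show ?case
  proof (cases "lin_dep K v J0 w")
    case False
    then show ?thesis using less.prems by blast
  next
    case True
    then obtain \<gamma> \<delta> where nz: "(\<exists>i\<in>K. \<gamma> i \<noteq> 0) \<or> (\<exists>j\<in>J0. \<delta> j \<noteq> 0)"
      and rel: "(\<Sum>i\<in>K. \<gamma> i *\<^sub>R v i) + (\<Sum>j\<in>J0. \<delta> j *\<^sub>R w j) = 0"
      by (auto simp: lin_dep_def)
    have "\<exists>j\<in>J0. \<delta> j \<noteq> 0"
    proof (rule ccontr)
      assume "\<not> (\<exists>j\<in>J0. \<delta> j \<noteq> 0)"
      then have "lin_dep K v {} w" using nz rel by (auto simp: lin_dep_def)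
      then show False using ind by blast
    qed
    then obtain j0 where j0: "j0 \<in> J0" "\<delta> j0 \<noteq> 0" by blast
    \<comment> \<open>The sign makes at least one coefficient of the relation positive, so that the ratio test is not vacuous.\<close>
    define \<sigma> where "\<sigma> = sgn (\<delta> j0)"
    define P where "P = {j\<in>J0. 0 < \<sigma> * \<delta> j}"
    have "j0 \<in> P" using j0 by (simp add: P_def \<sigma>_def sgn_if)
    moreover have "finite P" using less.prems by (simp add: P_def)
    ultimately obtain j1 where j1: "j1 \<in> P"
      and le: "\<And>j. j \<in> P \<Longrightarrow> \<beta>0 j1 / (\<sigma> * \<delta> j1) \<le> \<beta>0 j / (\<sigma> * \<delta> j)"
      using ex_min_if_finite[of "(\<lambda>j. \<beta>0 j / (\<sigma> * \<delta> j)) ` P"] by (fastforce simp: not_less)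
    \<comment> \<open>The largest step that keeps all coefficients nonnegative.\<close>
    define t where "t = \<beta>0 j1 / (\<sigma> * \<delta> j1)"
    have t: "0 \<le> t" using j1 less.prems by (auto simp: t_def P_def)
    define \<alpha>1 where "\<alpha>1 i = \<alpha>0 i - t * \<sigma> * \<gamma> i" for i
    define \<beta>1 where "\<beta>1 j = \<beta>0 j - t * \<sigma> * \<delta> j" for j
    have "0 < \<sigma> * \<delta> j1" using j1 unfolding P_def by blast
    then have "\<sigma> * \<delta> j1 \<noteq> 0" by (metis less_irrefl)
    then have "t * (\<sigma> * \<delta> j1) = \<beta>0 j1"
      unfolding t_def by (rule nonzero_eq_divide_eq[THEN iffD1]) simp
    then have zero: "\<beta>1 j1 = 0" by (simp only: \<beta>1_def mult.assoc diff_self)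
    have pos: "0 \<le> \<beta>1 j" if "j \<in> J0" for j
    proof (cases "j \<in> P")
      case True
      then have "t \<le> \<beta>0 j / (\<sigma> * \<delta> j)" using le by (simp add: t_def)
      then show ?thesis using True by (simp add: P_def \<beta>1_def pos_le_divide_eq mult.assoc)
    next
      case False
      then have "t * (\<sigma> * \<delta> j) \<le> 0"
        using t that by (simp add: P_def mult_nonneg_nonpos)
      then show ?thesis using less.prems that by (fastforce simp: \<beta>1_def mult.assoc)
    qed
    have "(\<Sum>i\<in>K. \<alpha>1 i *\<^sub>R v i) + (\<Sum>j\<in>J0. \<beta>1 j *\<^sub>R w j) =
      (\<Sum>i\<in>K. \<alpha>0 i *\<^sub>R v i) + (\<Sum>j\<in>J0. \<beta>0 j *\<^sub>R w j) -
      (t * \<sigma>) *\<^sub>R ((\<Sum>i\<in>K. \<gamma> i *\<^sub>R v i) + (\<Sum>j\<in>J0. \<delta> j *\<^sub>R w j))"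
      by (simp add: \<alpha>1_def \<beta>1_def scaleR_diff_left sum_subtractf scaleR_sum_right
          scaleR_right_distrib)
    also have "\<dots> = (\<Sum>i\<in>K. \<alpha>0 i *\<^sub>R v i) + (\<Sum>j\<in>J0. \<beta>0 j *\<^sub>R w j)"
      by (simp add: rel)
    finally have eq: "(\<Sum>i\<in>K. \<alpha>0 i *\<^sub>R v i) + (\<Sum>j\<in>J0. \<beta>0 j *\<^sub>R w j) =
      (\<Sum>i\<in>K. \<alpha>1 i *\<^sub>R v i) + (\<Sum>j\<in>J0 - {j1}. \<beta>1 j *\<^sub>R w j)"
      using j1 less.prems zero by (simp add: sum.remove[of J0 j1] P_def)
    have "card (J0 - {j1}) < card J0"
      using j1 less.prems unfolding P_def by (intro card_Diff1_less) blast+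
    from less.hyps[OF this, of \<beta>1 \<alpha>1] obtain J \<alpha> \<beta> where
      "J \<subseteq> J0 - {j1}" "\<forall>j\<in>J. 0 \<le> \<beta> j" "\<not> lin_dep K v J w"
      "(\<Sum>i\<in>K. \<alpha>1 i *\<^sub>R v i) + (\<Sum>j\<in>J0 - {j1}. \<beta>1 j *\<^sub>R w j) =
       (\<Sum>i\<in>K. \<alpha> i *\<^sub>R v i) + (\<Sum>j\<in>J. \<beta> j *\<^sub>R w j)"
      using pos less.prems by auto
    then show ?thesis unfolding eq by blast
  qed
qed

section \<open>Passing to the limit in the multipliers\<close>

lemma frequently_sequentially_subseq:
  assumes "\<exists>\<^sub>F k in sequentially. P k"
  shows "\<exists>r::nat \<Rightarrow> nat. strict_mono r \<and> (\<forall>k. P (r k))"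
proof -
  have "infinite {k. P k}"
    using assms by (simp add: cofinite_eq_sequentially[symmetric] frequently_cofinite)
  then show ?thesis using infinite_enumerate[of "{k. P k}"] by auto
qed

lemma bounded_family_convergent_subseq:
  fixes c :: "nat \<Rightarrow> 'i \<Rightarrow> real"
  assumes "finite S" and "\<forall>k. \<forall>i\<in>S. \<bar>c k i\<bar> \<le> b"
  shows "\<exists>r l. strict_mono r \<and> (\<forall>i\<in>S. (\<lambda>k. c (r k) i) \<longlonglongrightarrow> l i)"
  using assms
proof (induction S rule: finite_induct)
  case empty
  show ?case by (auto intro: exI[of _ id] simp: strict_mono_def)
next
  case (insert i S)
  then obtain r l where r: "strict_mono r" and l: "\<forall>j\<in>S. (\<lambda>k. c (r k) j) \<longlonglongrightarrow> l j"
    by auto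
  have "bounded (range (\<lambda>k. c (r k) i))"
    using insert.prems by (auto simp: bounded_iff)
  then obtain a r' where r': "strict_mono r'" and a: "((\<lambda>k. c (r k) i) \<circ> r') \<longlonglongrightarrow> a"
    using bounded_imp_convergent_subsequence by blast
  have "(\<lambda>k. c ((r \<circ> r') k) j) \<longlonglongrightarrow> (l(i := a)) j" if "j \<in> insert i S" for j
  proof (cases "j = i")
    case True
    then show ?thesis using a by (simp add: o_def)
  next
    case False
    then have "(\<lambda>k. c (r k) j) \<longlonglongrightarrow> l j" using l that by simp
    from LIMSEQ_subseq_LIMSEQ[OF this r'] False show ?thesis by (simp add: o_def)
  qed
  then show ?case using strict_mono_o[OF r r'] by blast
qed

text \<open>
  Normalizing the coefficients places them in a compact set, and the norm of a limit of
  coefficient vectors is again \<open>1\<close>: the limiting relation is therefore nontrivial. Signs survive,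
  which is what turns limits of nonnegative multipliers into positive linear dependence.
\<close>

lemma normalized_relation_limit:
  fixes V :: "nat \<Rightarrow> 'i \<Rightarrow> 'v::real_normed_vector" and c :: "nat \<Rightarrow> 'i \<Rightarrow> real"
  assumes S: "finite S" and V: "\<forall>i\<in>S. (\<lambda>k. V k i) \<longlonglongrightarrow> W i"
    and norm1: "\<forall>k. (\<Sum>i\<in>S. \<bar>c k i\<bar>) = 1"
    and rel: "(\<lambda>k. \<Sum>i\<in>S. c k i *\<^sub>R V k i) \<longlonglongrightarrow> 0"
  shows "\<exists>l. (\<Sum>i\<in>S. \<bar>l i\<bar>) = 1 \<and> (\<Sum>i\<in>S. l i *\<^sub>R W i) = 0 \<and>
    (\<forall>i\<in>S. (\<forall>k. 0 \<le> c k i) \<longrightarrow> 0 \<le> l i)"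
proof -
  have "\<bar>c k i\<bar> \<le> 1" if "i \<in> S" for k i
    using member_le_sum[OF that, of "\<lambda>i. \<bar>c k i\<bar>"] S norm1 by auto
  then obtain r l where r: "strict_mono r" and l: "\<forall>i\<in>S. (\<lambda>k. c (r k) i) \<longlonglongrightarrow> l i"
    using bounded_family_convergent_subseq[OF S] by blast
  have "(\<lambda>k. \<Sum>i\<in>S. \<bar>c (r k) i\<bar>) \<longlonglongrightarrow> (\<Sum>i\<in>S. \<bar>l i\<bar>)"
    using l by (auto intro!: tendsto_intros)
  then have 1: "(\<Sum>i\<in>S. \<bar>l i\<bar>) = 1"
    using norm1 by (simp add: LIMSEQ_const_iff)
  have "(\<lambda>k. V (r k) i) \<longlonglongrightarrow> W i" if "i \<in> S" for i
    using LIMSEQ_subseq_LIMSEQ[OF _ r, of "\<lambda>k. V k i" "W i"] V that by (simp add: o_def)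
  then have "(\<lambda>k. \<Sum>i\<in>S. c (r k) i *\<^sub>R V (r k) i) \<longlonglongrightarrow> (\<Sum>i\<in>S. l i *\<^sub>R W i)"
    using l by (auto intro!: tendsto_intros)
  moreover have "(\<lambda>k. \<Sum>i\<in>S. c (r k) i *\<^sub>R V (r k) i) \<longlonglongrightarrow> 0"
    using LIMSEQ_subseq_LIMSEQ[OF rel r] by (simp add: o_def)
  ultimately have 2: "(\<Sum>i\<in>S. l i *\<^sub>R W i) = 0" by (rule LIMSEQ_unique)
  have 3: "0 \<le> l i" if "i \<in> S" "\<forall>k. 0 \<le> c k i" for i
    using l that by (intro LIMSEQ_le_const[of "\<lambda>k. c (r k) i"]) auto
  show ?thesis using 1 2 3 by blast
qed

text \<open>
  Linear independence is an open condition: dependences along a subsequence, normalized, would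
  converge to a dependence of the limit family.
\<close>

lemma eventually_lin_indep:
  fixes V :: "nat \<Rightarrow> 'i \<Rightarrow> 'v::real_normed_vector" and w :: "'j \<Rightarrow> 'v" and w' :: "nat \<Rightarrow> 'j \<Rightarrow> 'v"
  assumes K: "finite K" and V: "\<forall>i\<in>K. (\<lambda>k. V k i) \<longlonglongrightarrow> W i" and ind: "\<not> lin_dep K W {} w"
  shows "\<forall>\<^sub>F k in sequentially. \<not> lin_dep K (V k) {} (w' k)"
proof (rule ccontr)
  assume "\<not> ?thesis"
  then have "\<exists>\<^sub>F k in sequentially. lin_dep K (V k) {} (w' k)" by (simp add: frequently_def)
  from frequently_sequentially_subseq[OF this] obtain r :: "nat \<Rightarrow> nat" where r: "strict_mono r"
    and dep: "\<And>k. lin_dep K (V (r k)) {} (w' (r k))"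
    by auto
  have "\<exists>c::'i \<Rightarrow> real. (\<Sum>i\<in>K. \<bar>c i\<bar>) = 1 \<and> (\<Sum>i\<in>K. c i *\<^sub>R V (r k) i) = 0" for k
  proof -
    obtain \<alpha> :: "'i \<Rightarrow> real" and i where a: "i \<in> K" "\<alpha> i \<noteq> 0"
      "(\<Sum>i\<in>K. \<alpha> i *\<^sub>R V (r k) i) = 0"
      using dep[of k] by (auto simp: lin_dep_def)
    define N where "N = (\<Sum>i\<in>K. \<bar>\<alpha> i\<bar>)"
    have "N > 0"
      unfolding N_def using a K by (intro sum_pos2[of K i]) auto
    moreover from \<open>N > 0\<close> have "(\<Sum>i\<in>K. \<bar>\<alpha> i / N\<bar>) = (\<Sum>i\<in>K. \<bar>\<alpha> i\<bar>) / N"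
      by (simp add: sum_divide_distrib)
    moreover have "(\<Sum>i\<in>K. \<bar>\<alpha> i\<bar>) / N = 1" using \<open>N > 0\<close> unfolding N_def by simp
    moreover have "(\<Sum>i\<in>K. (\<alpha> i / N) *\<^sub>R V (r k) i) = (1 / N) *\<^sub>R (\<Sum>i\<in>K. \<alpha> i *\<^sub>R V (r k) i)"
      by (simp add: scaleR_sum_right)
    ultimately show ?thesis using a by (intro exI[of _ "\<lambda>i. \<alpha> i / N"]) simp
  qed
  then obtain c where c: "\<And>k. (\<Sum>i\<in>K. \<bar>c k i\<bar>) = (1::real)"
      "\<And>k. (\<Sum>i\<in>K. c k i *\<^sub>R V (r k) i) = 0"
    by metis
  have "\<forall>i\<in>K. (\<lambda>k. V (r k) i) \<longlonglongrightarrow> W i"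
    using LIMSEQ_subseq_LIMSEQ[OF _ r] V by (fastforce simp: o_def)
  from normalized_relation_limit[OF K this, of c] c
  obtain l where "(\<Sum>i\<in>K. \<bar>l i\<bar>) = 1" "(\<Sum>i\<in>K. l i *\<^sub>R W i) = 0" by auto
  moreover have "\<exists>i\<in>K. l i \<noteq> 0" using \<open>(\<Sum>i\<in>K. \<bar>l i\<bar>) = 1\<close> by (rule_tac ccontr) simp
  ultimately show False using ind by (auto simp: lin_dep_def)
qed

text \<open>
  What remains of the theorem when manifold and functions are forgotten. Caratheodory's lemma replaces the multipliers by new ones,
  supported on \<open>K\<close> and on an index set along which the gradients are independent; since \<open>Act\<close> has
  finitely many subsets, one set \<open>J\<close> serves for infinitely many \<open>k\<close>. There the hypothesis on
  dependence, read backwards, says that the limit family is not positive-linearly dependent.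

  The new multipliers are now bounded, but there is no need to show it first: the
  relation is homogenized by giving \<open>F\<close> a coefficient as well, as in the Fritz John conditions.
  After normalization it passes to the limit, and the coefficient of \<open>F0\<close> cannot vanish, because
  the remaining terms would then be a positive-linear dependence.
\<close>

proposition multipliers_in_the_limit:
  fixes F :: "nat \<Rightarrow> 'v::real_normed_vector" and H :: "nat \<Rightarrow> 'i \<Rightarrow> 'v" and G :: "nat \<Rightarrow> 'j \<Rightarrow> 'v"
  assumes I: "finite I" "K \<subseteq> I" and Act: "finite Act"
    and F: "F \<longlonglongrightarrow> F0"
    and H: "\<forall>i\<in>I. (\<lambda>k. H k i) \<longlonglongrightarrow> H0 i"
    and G: "\<forall>j\<in>Act. (\<lambda>k. G k j) \<longlonglongrightarrow> G0 j"
    and ind: "\<not> lin_dep K H0 {} G0"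
    and spanning: "\<forall>\<^sub>F k in sequentially. \<forall>i\<in>I. H k i \<in> span (H k ` K)"
    and cpld: "\<forall>J\<subseteq>Act. pos_lin_dep K H0 J G0 \<longrightarrow> (\<forall>\<^sub>F k in sequentially. lin_dep K (H k) J (G k))"
    and nonneg: "\<forall>k. \<forall>j\<in>Act. 0 \<le> \<mu> k j"
    and lim: "(\<lambda>k. F k + (\<Sum>i\<in>I. lam k i *\<^sub>R H k i) + (\<Sum>j\<in>Act. \<mu> k j *\<^sub>R G k j)) \<longlonglongrightarrow> 0"
      (is "?R \<longlonglongrightarrow> 0")
  shows "\<exists>lam \<mu>. (\<forall>j\<in>Act. 0 \<le> \<mu> j) \<and>
    F0 + (\<Sum>i\<in>I. lam i *\<^sub>R H0 i) + (\<Sum>j\<in>Act. \<mu> j *\<^sub>R G0 j) = 0"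
proof -
  have K: "finite K" using I finite_subset by blast
  define Q where "Q k J \<longleftrightarrow> (\<exists>\<alpha> \<beta>. (\<forall>j\<in>J. 0 \<le> \<beta> j) \<and> \<not> lin_dep K (H k) J (G k) \<and>
    ?R k = F k + (\<Sum>i\<in>K. \<alpha> i *\<^sub>R H k i) + (\<Sum>j\<in>J. \<beta> j *\<^sub>R G k j))" for k J
  have "\<forall>\<^sub>F k in sequentially. \<not> lin_dep K (H k) {} (G k)"
    using I H ind by (intro eventually_lin_indep[OF K, of H H0 G0]) auto
  with spanning have "\<forall>\<^sub>F k in sequentially. \<exists>J\<in>Pow Act. Q k J"
  proof eventually_elim
    case (elim k)
    have "(\<Sum>i\<in>I. lam k i *\<^sub>R H k i) \<in> span (H k ` K)"
      using elim by (intro span_sum span_scale) auto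
    from span_family[OF K this] obtain \<alpha>
      where "(\<Sum>i\<in>I. lam k i *\<^sub>R H k i) = (\<Sum>i\<in>K. \<alpha> i *\<^sub>R H k i)" ..
    moreover obtain J \<alpha>' \<beta>' where "J \<subseteq> Act" "\<forall>j\<in>J. 0 \<le> \<beta>' j" "\<not> lin_dep K (H k) J (G k)"
      "(\<Sum>i\<in>K. \<alpha> i *\<^sub>R H k i) + (\<Sum>j\<in>Act. \<mu> k j *\<^sub>R G k j) =
       (\<Sum>i\<in>K. \<alpha>' i *\<^sub>R H k i) + (\<Sum>j\<in>J. \<beta>' j *\<^sub>R G k j)"
      using caratheodory_multipliers[OF K _ Act, of "H k" "G k" "\<mu> k" \<alpha>] elim nonneg by blast
    ultimately show ?case
      unfolding Q_def by (intro bexI[of _ J] exI[of _ \<alpha>'] exI[of _ \<beta>']) (auto simp: add.assoc)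
  qed
  then have "\<exists>J\<in>Pow Act. \<exists>\<^sub>F k in sequentially. Q k J"
  proof (rule contrapos_pp)
    assume "\<not> (\<exists>J\<in>Pow Act. \<exists>\<^sub>F k in sequentially. Q k J)"
    then have "\<forall>\<^sub>F k in sequentially. \<forall>J\<in>Pow Act. \<not> Q k J"
      using Act by (intro eventually_ball_finite) (auto simp: frequently_def)
    then have none: "\<forall>\<^sub>F k in sequentially. \<forall>J\<in>Pow Act. \<not> Q k J" .
    show "\<not> (\<forall>\<^sub>F k in sequentially. \<exists>J\<in>Pow Act. Q k J)"
    proof
      assume "\<forall>\<^sub>F k in sequentially. \<exists>J\<in>Pow Act. Q k J"
      with none have "\<forall>\<^sub>F k in sequentially. False" by eventually_elim blast
      then show False by simp
    qed
  qed
  then obtain J where J: "J \<subseteq> Act" and "\<exists>\<^sub>F k in sequentially. Q k J" by blast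
  from frequently_sequentially_subseq[OF this(2)] obtain r :: "nat \<Rightarrow> nat"
    where r: "strict_mono r" and Q: "\<And>k. Q (r k) J"
    by blast
  have finJ: "finite J" using J Act finite_subset by blast
  have notpos: "\<not> pos_lin_dep K H0 J G0"
  proof
    assume "pos_lin_dep K H0 J G0"
    then obtain N where "\<forall>k\<ge>N. lin_dep K (H k) J (G k)"
      using cpld J by (auto simp: eventually_sequentially)
    then have "lin_dep K (H (r N)) J (G (r N))" using seq_suble[OF r] by blast
    then show False using Q[of N] by (auto simp: Q_def)
  qed
  obtain \<alpha> \<beta> where pos: "\<And>k j. j \<in> J \<Longrightarrow> 0 \<le> \<beta> k j"
    and R: "\<And>k. ?R (r k) = F (r k) + (\<Sum>i\<in>K. \<alpha> k i *\<^sub>R H (r k) i) + (\<Sum>j\<in>J. \<beta> k j *\<^sub>R G (r k) j)"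
    using Q unfolding Q_def by metis
  \<comment> \<open>One index set for the whole homogenized relation: \<open>None\<close> stands for the objective.\<close>
  define S where "S = insert None (Some ` (K <+> J))"
  have S_sum: "sum z S = z None + (\<Sum>i\<in>K. z (Some (Inl i))) + (\<Sum>j\<in>J. z (Some (Inr j)))"
    for z :: "('i + 'j) option \<Rightarrow> 'x::comm_monoid_add"
    using K finJ by (simp add: S_def sum.reindex sum.Plus o_def add.assoc image_iff)
  define V where "V k = case_option (F (r k)) (case_sum (H (r k)) (G (r k)))" for k
  define W where "W = case_option F0 (case_sum H0 G0)"
  define c0 where "c0 k = case_option (1::real) (case_sum (\<alpha> k) (\<beta> k))" for k
  define M where "M k = (\<Sum>i\<in>S. \<bar>c0 k i\<bar>)" for k
  have M: "1 \<le> M k" for k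
    unfolding M_def S_sum by (simp add: c0_def sum_nonneg)
  define c where "c k i = c0 k i / M k" for k i
  have sub: "(\<lambda>k. x (r k)) \<longlonglongrightarrow> a" if "x \<longlonglongrightarrow> a" for x :: "nat \<Rightarrow> 'v" and a
    using LIMSEQ_subseq_LIMSEQ[OF that r] by (simp add: o_def)
  have "(\<lambda>k. H (r k) i) \<longlonglongrightarrow> H0 i" if "i \<in> K" for i
    using H I that by (intro sub[of "\<lambda>k. H k i"]) blast
  moreover have "(\<lambda>k. G (r k) j) \<longlonglongrightarrow> G0 j" if "j \<in> J" for j
    using G J that by (intro sub[of "\<lambda>k. G k j"]) blast
  ultimately have V_lim: "\<forall>i\<in>S. (\<lambda>k. V k i) \<longlonglongrightarrow> W i"
    using sub[OF F] by (auto simp: S_def V_def W_def)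
  have c_norm: "\<forall>k. (\<Sum>i\<in>S. \<bar>c k i\<bar>) = 1"
  proof
    fix k
    have "(\<Sum>i\<in>S. \<bar>c k i\<bar>) = (\<Sum>i\<in>S. \<bar>c0 k i\<bar>) / M k"
      using M[of k] by (simp add: c_def sum_divide_distrib)
    also have "\<dots> = M k / M k" by (simp only: M_def)
    finally show "(\<Sum>i\<in>S. \<bar>c k i\<bar>) = 1" using M[of k] by simp
  qed
  have c_rel: "(\<lambda>k. \<Sum>i\<in>S. c k i *\<^sub>R V k i) \<longlonglongrightarrow> 0"
  proof (rule Lim_null_comparison)
    show "\<forall>\<^sub>F k in sequentially. norm (\<Sum>i\<in>S. c k i *\<^sub>R V k i) \<le> norm (?R (r k))"
    proof (intro always_eventually allI)
      fix k
      have "(\<Sum>i\<in>S. c k i *\<^sub>R V k i) = (1 / M k) *\<^sub>R ?R (r k)"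
        unfolding R S_sum
        by (simp add: c_def c0_def V_def scaleR_right_distrib scaleR_sum_right)
      then have "norm (\<Sum>i\<in>S. c k i *\<^sub>R V k i) = norm (?R (r k)) / M k" using M[of k] by simp
      also have "\<dots> \<le> norm (?R (r k))" using M[of k] mult_left_mono[of 1 "M k" "norm (?R (r k))"] by (simp add: divide_le_eq)
      finally show "norm (\<Sum>i\<in>S. c k i *\<^sub>R V k i) \<le> norm (?R (r k))" .
    qed
    show "(\<lambda>k. norm (?R (r k))) \<longlonglongrightarrow> 0"
      using tendsto_norm_zero[OF LIMSEQ_subseq_LIMSEQ[OF lim r]] by (simp add: o_def)
  qed
  have "finite S" using K finJ by (simp add: S_def)
  from normalized_relation_limit[OF this V_lim c_norm c_rel]
  obtain l where l1: "(\<Sum>i\<in>S. \<bar>l i\<bar>) = 1" and l0: "(\<Sum>i\<in>S. l i *\<^sub>R W i) = 0"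
    and lpos: "\<And>i. i \<in> S \<Longrightarrow> \<forall>k. 0 \<le> c k i \<Longrightarrow> 0 \<le> l i"
    by blast
  have c_None: "0 \<le> l None"
    using M by (intro lpos) (auto simp: S_def c_def c0_def intro: order_trans[OF zero_le_one])
  have c_J: "0 \<le> l (Some (Inr j))" if "j \<in> J" for j
    using M pos that
    by (intro lpos) (auto simp: S_def c_def c0_def intro!: divide_nonneg_nonneg
        intro: order_trans[OF zero_le_one])
  have rel: "l None *\<^sub>R F0 + (\<Sum>i\<in>K. l (Some (Inl i)) *\<^sub>R H0 i)
      + (\<Sum>j\<in>J. l (Some (Inr j)) *\<^sub>R G0 j) = 0"
    using l0 unfolding S_sum by (simp add: W_def)
  have "l None \<noteq> 0"
  proof
    assume None: "l None = 0"
    have "(\<exists>i\<in>K. l (Some (Inl i)) \<noteq> 0) \<or> (\<exists>j\<in>J. l (Some (Inr j)) \<noteq> 0)"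
      using l1 None unfolding S_sum by (rule_tac ccontr) simp
    then have "pos_lin_dep K H0 J G0"
      unfolding pos_lin_dep_def using rel None c_J
      by (intro exI[of _ "\<lambda>i. l (Some (Inl i))"] exI[of _ "\<lambda>j. l (Some (Inr j))"]) auto
    then show False using notpos by blast
  qed
  define lam' where "lam' i = (if i \<in> K then l (Some (Inl i)) / l None else 0)" for i
  define \<mu>' where "\<mu>' j = (if j \<in> J then l (Some (Inr j)) / l None else 0)" for j
  have "(\<Sum>i\<in>I. lam' i *\<^sub>R H0 i) = (\<Sum>i\<in>K. lam' i *\<^sub>R H0 i)"
    using I by (intro sum.mono_neutral_right) (auto simp: lam'_def)
  moreover have "(\<Sum>j\<in>Act. \<mu>' j *\<^sub>R G0 j) = (\<Sum>j\<in>J. \<mu>' j *\<^sub>R G0 j)"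
    using Act J by (intro sum.mono_neutral_right) (auto simp: \<mu>'_def)
  moreover have "F0 + (\<Sum>i\<in>K. lam' i *\<^sub>R H0 i) + (\<Sum>j\<in>J. \<mu>' j *\<^sub>R G0 j) =
     (1 / l None) *\<^sub>R (l None *\<^sub>R F0 + (\<Sum>i\<in>K. l (Some (Inl i)) *\<^sub>R H0 i)
      + (\<Sum>j\<in>J. l (Some (Inr j)) *\<^sub>R G0 j))"
    using \<open>l None \<noteq> 0\<close>
    by (simp add: lam'_def \<mu>'_def scaleR_right_distrib scaleR_sum_right)
  ultimately have "F0 + (\<Sum>i\<in>I. lam' i *\<^sub>R H0 i) + (\<Sum>j\<in>Act. \<mu>' j *\<^sub>R G0 j) = 0"
    using rel by simp
  moreover have "\<forall>j\<in>Act. 0 \<le> \<mu>' j" using c_J c_None by (simp add: \<mu>'_def)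
  ultimately show ?thesis by blast
qed

section \<open>Forms on Euclidean space\<close>

text \<open>
  The Riesz representation of a functional with respect to the Euclidean inner product, with an
  explicit formula that makes the continuity of coordinate gradients evident.
\<close>

lemma linear_functional_gradient:
  fixes L :: "'v::euclidean_space \<Rightarrow> real"
  assumes "linear L"
  shows "(\<Sum>b\<in>Basis. L b *\<^sub>R b) \<bullet> v = L v"
proof -
  have "L v = L (\<Sum>b\<in>Basis. (v \<bullet> b) *\<^sub>R b)" by (simp add: euclidean_representation)
  also have "\<dots> = (\<Sum>b\<in>Basis. (v \<bullet> b) * L b)"
    by (simp add: linear_sum[OF assms] linear_scale[OF assms])
  also have "\<dots> = (\<Sum>b\<in>Basis. L b *\<^sub>R b) \<bullet> v"
    by (simp add: inner_sum_left inner_commute[of v] mult.commute)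
  finally show ?thesis ..
qed

text \<open>
  The inner product of a tangent space is a form on coordinate vectors that varies with the base
  point, so it is no instance of the type class of inner product spaces.
\<close>

lemma form_cauchy_schwarz:
  fixes B :: "'v::real_vector \<Rightarrow> 'v \<Rightarrow> real"
  assumes B: "bilinear B" and sym: "\<And>u w. B u w = B w u" and pos: "\<And>u. u \<noteq> 0 \<Longrightarrow> 0 < B u u"
  shows "\<bar>B u w\<bar> \<le> sqrt (B u u) * sqrt (B w w)"
proof (cases "w = 0")
  case True
  then show ?thesis by (simp add: bilinear_rzero[OF B])
next
  case False
  \<comment> \<open>\<open>t *\<^sub>R w\<close> is the orthogonal projection of \<open>u\<close> to the line spanned by \<open>w\<close>.\<close>
  define t where "t = B u w / B w w"
  have w: "0 < B w w" using pos False by blast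
  have "0 \<le> B (u - t *\<^sub>R w) (u - t *\<^sub>R w)"
    using pos[of "u - t *\<^sub>R w"] bilinear_rzero[OF B] by (cases "u - t *\<^sub>R w = 0") auto
  also have "\<dots> = B u u - 2 * t * B u w + t * t * B w w"
    by (simp add: bilinear_lsub[OF B] bilinear_rsub[OF B] bilinear_lmul[OF B] bilinear_rmul[OF B]
        sym[of w u] algebra_simps)
  also have "\<dots> = B u u - (B u w)\<^sup>2 / B w w"
    using w by (simp add: t_def power2_eq_square field_simps)
  finally have "(B u w)\<^sup>2 \<le> B u u * B w w" using w by (simp add: field_simps)
  then have "sqrt ((B u w)\<^sup>2) \<le> sqrt (B u u * B w w)" by (rule real_sqrt_le_mono)
  then show ?thesis by (simp add: real_sqrt_mult)
qed

lemma form_le_norm: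
  fixes B :: "'v::euclidean_space \<Rightarrow> 'v \<Rightarrow> real"
  assumes B: "bilinear B" and M: "\<And>a b. a \<in> Basis \<Longrightarrow> b \<in> Basis \<Longrightarrow> \<bar>B a b\<bar> \<le> M"
  shows "B v v \<le> M * (real DIM('v) * norm v)\<^sup>2"
proof -
  have "B v v = B (\<Sum>a\<in>Basis. (v \<bullet> a) *\<^sub>R a) (\<Sum>b\<in>Basis. (v \<bullet> b) *\<^sub>R b)"
    by (simp add: euclidean_representation)
  also have "\<dots> = (\<Sum>(a, b)\<in>Basis \<times> Basis. (v \<bullet> a) * (v \<bullet> b) * B a b)"
    unfolding bilinear_sum[OF B]
    by (rule sum.cong) (auto simp: bilinear_lmul[OF B] bilinear_rmul[OF B])
  also have "\<dots> \<le> (\<Sum>(a, b)\<in>(Basis :: 'v set) \<times> (Basis :: 'v set). norm v * norm v * M)"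
  proof (rule sum_mono, clarify)
    fix a b :: 'v assume ab: "a \<in> Basis" "b \<in> Basis"
    have "\<bar>(v \<bullet> a) * (v \<bullet> b) * B a b\<bar> \<le> norm v * norm v * M"
      unfolding abs_mult using ab by (intro mult_mono M Basis_le_norm) auto
    then show "(v \<bullet> a) * (v \<bullet> b) * B a b \<le> norm v * norm v * M" by linarith
  qed
  also have "\<dots> = M * (real DIM('v) * norm v)\<^sup>2"
    by (simp add: card_cartesian_product power2_eq_square)
  finally show ?thesis .
qed

section \<open>Tangent vectors and the metric in a chart\<close>

lemma smooth_on_C1:
  assumes "smooth_on S f"
  shows "x \<in> S \<Longrightarrow> f differentiable (at x)"
    and "continuous_on S (\<lambda>x. frechet_derivative f (at x) v)"
    and "continuous_on S f"
proof -
  have "Ck_on (Suc 0) f S" "Ck_on 0 f S" using assms unfolding smooth_on_def by blast+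
  then show "x \<in> S \<Longrightarrow> f differentiable (at x)"
    "continuous_on S (\<lambda>x. frechet_derivative f (at x) v)" "continuous_on S f"
    by auto
qed

text \<open>
  The theorem is local, so everything is expressed in one fixed chart \<open>c\<close> around the point of
  interest. The other charts appear only because differentiability, tangent vectors and curves
  are defined with reference to the whole atlas.
\<close>

locale riemannian_chart =
  fixes A :: "('a::{t2_space, second_countable_topology}, 'n::finite) chart set"
    and G :: "'a \<Rightarrow> (('a \<Rightarrow> real) \<Rightarrow> real) \<Rightarrow> (('a \<Rightarrow> real) \<Rightarrow> real) \<Rightarrow> real"
    and c :: "('a, 'n) chart"
  assumes atlas: "smooth_atlas A" and metric: "riemannian_metric A G" and chart: "c \<in> A"
begin

lemma chart_facts:
  assumes "c' \<in> A"
  shows "open (fst c')" "open (chart_img c')" "continuous_on (fst c') (snd c')"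
    "continuous_on (chart_img c') (chart_inv c')"
    "q \<in> fst c' \<Longrightarrow> chart_inv c' (snd c' q) = q"
  using atlas assms unfolding smooth_atlas_def homeomorphism_def by blast+

lemma open_overlap:
  assumes "c1 \<in> A" "c2 \<in> A"
  shows "open (snd c1 ` (fst c1 \<inter> fst c2))"
proof -
  have "snd c1 ` (fst c1 \<inter> fst c2) = chart_img c1 \<inter> chart_inv c1 -` fst c2"
    using chart_facts(5)[OF assms(1)] by force
  then show ?thesis
    using continuous_open_preimage[of "chart_img c1" "chart_inv c1" "fst c2"] chart_facts assms by simp
qed

lemma transition:
  assumes "c1 \<in> A" "c2 \<in> A"
  shows "x \<in> snd c1 ` (fst c1 \<inter> fst c2) \<Longrightarrow>
      ((snd c2 \<circ> chart_inv c1) has_derivative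
        frechet_derivative (snd c2 \<circ> chart_inv c1) (at x)) (at x)"
    and "continuous_on (snd c1 ` (fst c1 \<inter> fst c2))
      (\<lambda>x. frechet_derivative (snd c2 \<circ> chart_inv c1) (at x) v)"
proof -
  have sm: "smooth_on (snd c1 ` (fst c1 \<inter> fst c2)) (snd c2 \<circ> chart_inv c1)"
    using atlas assms unfolding smooth_atlas_def by blast
  show "x \<in> snd c1 ` (fst c1 \<inter> fst c2) \<Longrightarrow>
      ((snd c2 \<circ> chart_inv c1) has_derivative
        frechet_derivative (snd c2 \<circ> chart_inv c1) (at x)) (at x)"
    using smooth_on_C1(1)[OF sm] by (simp add: frechet_derivative_works)
  show "continuous_on (snd c1 ` (fst c1 \<inter> fst c2))
      (\<lambda>x. frechet_derivative (snd c2 \<circ> chart_inv c1) (at x) v)"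
    by (rule smooth_on_C1(2)[OF sm])
qed

lemma has_derivative_change_chart:
  assumes c12: "c1 \<in> A" "c2 \<in> A" and q: "q \<in> fst c1" "q \<in> fst c2"
    and D: "((f \<circ> chart_inv c2) has_derivative D) (at (snd c2 q))"
  shows "((f \<circ> chart_inv c1) has_derivative
    (D \<circ> frechet_derivative (snd c2 \<circ> chart_inv c1) (at (snd c1 q)))) (at (snd c1 q))"
proof -
  let ?T = "snd c2 \<circ> chart_inv c1"
  have mem: "snd c1 q \<in> snd c1 ` (fst c1 \<inter> fst c2)" using q by blast
  have "((f \<circ> chart_inv c2) has_derivative D) (at (?T (snd c1 q)))"
    using D chart_facts(5)[OF c12(1) q(1)] by simp
  from diff_chain_at[OF transition(1)[OF c12 mem] this]
  have "(((f \<circ> chart_inv c2) \<circ> ?T) has_derivative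
     (D \<circ> frechet_derivative ?T (at (snd c1 q)))) (at (snd c1 q))" .
  then show ?thesis
    by (rule has_derivative_transform_within_open[OF _ open_overlap[OF c12] mem])
       (auto simp: chart_facts(5)[OF c12(1)] chart_facts(5)[OF c12(2)])
qed

lemma differentiable_at_pt_iff:
  assumes "q \<in> fst c"
  shows "differentiable_at_pt A q f \<longleftrightarrow> (f \<circ> chart_inv c) differentiable (at (snd c q))"
proof
  assume "differentiable_at_pt A q f"
  then obtain c' D where "c' \<in> A" "q \<in> fst c'"
      "((f \<circ> chart_inv c') has_derivative D) (at (snd c' q))"
    unfolding differentiable_at_pt_def differentiable_def by blast
  from has_derivative_change_chart[OF chart this(1) assms this(2,3)]
  show "(f \<circ> chart_inv c) differentiable (at (snd c q))"
    unfolding differentiable_def by blast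
next
  assume "(f \<circ> chart_inv c) differentiable (at (snd c q))"
  then show "differentiable_at_pt A q f"
    using chart assms unfolding differentiable_at_pt_def by blast
qed

lemma coord_vector_change_chart:
  assumes c': "c' \<in> A" and q: "q \<in> fst c" "q \<in> fst c'"
  shows "coord_vector A c' q v =
    coord_vector A c q (frechet_derivative (snd c \<circ> chart_inv c') (at (snd c' q)) v)"
proof
  fix f
  show "coord_vector A c' q v f =
    coord_vector A c q (frechet_derivative (snd c \<circ> chart_inv c') (at (snd c' q)) v) f"
  proof (cases "differentiable_at_pt A q f")
    case True
    then have "((f \<circ> chart_inv c) has_derivative
        frechet_derivative (f \<circ> chart_inv c) (at (snd c q))) (at (snd c q))"
      by (simp add: differentiable_at_pt_iff[OF q(1)] frechet_derivative_works)
    from frechet_derivative_at[OF has_derivative_change_chart[OF c' chart q(2,1) this]]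
    show ?thesis using True by (simp add: coord_vector_def o_def fun_eq_iff)
  qed (simp add: coord_vector_def)
qed

text \<open>
  Tangent vectors are defined through all charts; the chain rule, applied to the transition map,
  shows that one chart suffices.
\<close>

lemma tangent_space_eq:
  assumes "q \<in> fst c"
  shows "tangent_space A q = range (coord_vector A c q)"
  using coord_vector_change_chart[OF _ assms] chart assms
  unfolding tangent_space_def by blast

lemma linear_coord_vector:
  assumes q: "q \<in> fst c"
  shows "linear (coord_vector A c q)"
proof (rule linearI)
  have lin: "linear (frechet_derivative (f \<circ> chart_inv c) (at (snd c q)))"
    if "differentiable_at_pt A q f" for f
    using that by (simp add: differentiable_at_pt_iff[OF q] linear_frechet_derivative)
  fix v w :: "real ^ 'n" and r :: real
  show "coord_vector A c q (v + w) = coord_vector A c q v + coord_vector A c q w"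
    using linear_add[OF lin] by (auto simp: coord_vector_def plus_fun_def fun_eq_iff)
  show "coord_vector A c q (r *\<^sub>R v) = r *\<^sub>R coord_vector A c q v"
    using linear_scale[OF lin] by (auto simp: coord_vector_def scaleR_fun_def fun_eq_iff)
qed

text \<open>
  The components of a coordinate vector are recovered by applying the operator to the coordinate
  functions, which are differentiable no matter how the chart map behaves off its domain.
\<close>

lemma inj_coord_vector:
  assumes q: "q \<in> fst c"
  shows "inj (coord_vector A c q)"
proof (rule injI)
  fix v w assume eq: "coord_vector A c q v = coord_vector A c q w"
  have "v $ i = w $ i" for i
  proof -
    let ?x = "\<lambda>y. snd c y $ i"
    have "((\<lambda>x::real^'n. x $ i) has_derivative (\<lambda>v. v $ i)) (at (snd c q))"
      by (rule bounded_linear_imp_has_derivative[OF bounded_linear_vec_nth])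
    then have D: "((?x \<circ> chart_inv c) has_derivative (\<lambda>v. v $ i)) (at (snd c q))"
      by (rule has_derivative_transform_within_open[of _ _ _ _ "chart_img c"])
         (use q chart_facts[OF chart] in auto)
    then have "differentiable_at_pt A q ?x"
      unfolding differentiable_at_pt_iff[OF q] differentiable_def by blast
    moreover have "frechet_derivative (?x \<circ> chart_inv c) (at (snd c q)) = (\<lambda>v. v $ i)"
      using frechet_derivative_at[OF D] by simp
    ultimately have "coord_vector A c q u ?x = u $ i" for u
      by (simp add: coord_vector_def)
    then show ?thesis using eq by metis
  qed
  then show "v = w" by (simp add: vec_eq_iff)
qed

definition metric_form :: "'a \<Rightarrow> real ^ 'n \<Rightarrow> real ^ 'n \<Rightarrow> real" where
  "metric_form q v w = G q (coord_vector A c q v) (coord_vector A c q w)"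

lemma metric_form_sym:
  assumes "q \<in> fst c"
  shows "metric_form q v w = metric_form q w v"
  using metric assms unfolding riemannian_metric_def metric_form_def by (simp add: tangent_space_eq)

lemma metric_form_pos:
  assumes q: "q \<in> fst c" and v: "v \<noteq> 0"
  shows "0 < metric_form q v v"
proof -
  have "coord_vector A c q v \<noteq> 0"
    using v inj_coord_vector[OF q] linear_0[OF linear_coord_vector[OF q]] by (metis injD)
  then show ?thesis
    using metric q unfolding riemannian_metric_def metric_form_def by (simp add: tangent_space_eq)
qed

lemma bilinear_metric_form:
  assumes q: "q \<in> fst c"
  shows "bilinear (metric_form q)"
proof -
  have comb: "metric_form q (a *\<^sub>R u + b *\<^sub>R v) w = a * metric_form q u w + b * metric_form q v w"
    for a b u v w
  proof -
    have "coord_vector A c q (a *\<^sub>R u + b *\<^sub>R v) =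
        a *\<^sub>R coord_vector A c q u + b *\<^sub>R coord_vector A c q v"
      by (simp add: linear_add[OF linear_coord_vector[OF q]] linear_scale[OF linear_coord_vector[OF q]])
    then show ?thesis
      using metric q unfolding riemannian_metric_def metric_form_def by (simp add: tangent_space_eq)
  qed
  have lin: "linear (\<lambda>v. metric_form q v w)" for w
  proof (rule linearI)
    show "metric_form q (u + v) w = metric_form q u w + metric_form q v w" for u v
      using comb[of 1 u 1 v w] by simp
    show "metric_form q (r *\<^sub>R v) w = r *\<^sub>R metric_form q v w" for r v
      using comb[of r v 0 v w] by simp
  qed
  moreover have "linear (metric_form q w)" for w
  proof -
    have "metric_form q w = (\<lambda>v. metric_form q v w)" by (rule ext) (rule metric_form_sym[OF q])
    then show ?thesis using lin by metis
  qed
  ultimately show ?thesis by (simp add: bilinear_def)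
qed

lemma tangent_norm_coord_vector:
  "tangent_norm G q (coord_vector A c q v) = sqrt (metric_form q v v)"
  by (simp add: tangent_norm_def metric_form_def)

text \<open>
  Near \<open>p\<close> the Riemannian norm is dominated by a fixed multiple of the Euclidean norm, since the
  entries of the metric tensor are continuous. This single bound serves two purposes: it shows
  that Riemannian balls are neighbourhoods, and, by duality, that small Riemannian gradients
  have small coordinate gradients.
\<close>

lemma tangent_norm_le:
  assumes p: "p \<in> fst c"
  shows "\<exists>C>0. \<exists>\<delta>>0. ball (snd c p) \<delta> \<subseteq> chart_img c \<and>
    (\<forall>x\<in>ball (snd c p) \<delta>. \<forall>v.
      tangent_norm G (chart_inv c x) (coord_vector A c (chart_inv c x) v) \<le> C * norm v)"
proof -
  let ?x = "snd c p"
  let ?B = "\<lambda>x. metric_form (chart_inv c x)"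
  \<comment> \<open>Strictly larger than all entries at the centre, so that the bound persists nearby.\<close>
  define M where "M = 1 + (\<Sum>(a, b)\<in>Basis \<times> Basis. \<bar>?B ?x a b\<bar>)"
  have M: "\<bar>?B ?x a b\<bar> < M" if "a \<in> Basis" "b \<in> Basis" for a b
  proof -
    have "(\<lambda>(a, b). \<bar>?B ?x a b\<bar>) (a, b) \<le> (\<Sum>(a, b)\<in>Basis \<times> Basis. \<bar>?B ?x a b\<bar>)"
      using that by (intro member_le_sum) auto
    then show ?thesis by (simp add: M_def)
  qed
  have "M > 0" unfolding M_def by (intro add_pos_nonneg sum_nonneg) auto
  have ev1: "\<forall>\<^sub>F x in nhds ?x. x \<in> chart_img c"
    using p chart_facts[OF chart] by (intro eventually_nhds_in_open) auto
  have "\<forall>\<^sub>F x in nhds ?x. \<bar>?B x a b\<bar> < M" if "a \<in> Basis" "b \<in> Basis" for a b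
  proof -
    have "smooth_on (chart_img c) (\<lambda>x. ?B x a b)"
      using metric chart unfolding riemannian_metric_def metric_form_def by blast
    then have "continuous_on (chart_img c) (\<lambda>x. ?B x a b)" by (rule smooth_on_C1)
    then have "isCont (\<lambda>x. ?B x a b) ?x"
      using p chart_facts[OF chart] by (auto simp: continuous_on_eq_continuous_at)
    then have "((\<lambda>x. \<bar>?B x a b\<bar>) \<longlongrightarrow> \<bar>?B ?x a b\<bar>) (nhds ?x)"
      using tendsto_at_iff_tendsto_nhds[of "\<lambda>x. ?B x a b" ?x]
      by (intro tendsto_rabs) (simp add: isCont_def)
    then show ?thesis using M[OF that] by (rule order_tendstoD)
  qed
  then have "\<forall>\<^sub>F x in nhds ?x. \<forall>a\<in>Basis. \<forall>b\<in>Basis. \<bar>?B x a b\<bar> < M"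
    by (intro eventually_ball_finite ballI finite_Basis)
  with ev1 have "\<forall>\<^sub>F x in nhds ?x. x \<in> chart_img c \<and> (\<forall>a\<in>Basis. \<forall>b\<in>Basis. \<bar>?B x a b\<bar> < M)"
    by eventually_elim simp
  then obtain \<delta> where "\<delta> > 0" and \<delta>:
    "\<And>x. dist x ?x < \<delta> \<Longrightarrow> x \<in> chart_img c \<and> (\<forall>a\<in>Basis. \<forall>b\<in>Basis. \<bar>?B x a b\<bar> < M)"
    unfolding eventually_nhds_metric by blast
  define C where "C = sqrt M * real DIM(real ^ 'n)"
  have "tangent_norm G (chart_inv c x) (coord_vector A c (chart_inv c x) v) \<le> C * norm v"
    if "x \<in> ball ?x \<delta>" for x v
  proof -
    have x: "x \<in> chart_img c" "\<forall>a\<in>Basis. \<forall>b\<in>Basis. \<bar>?B x a b\<bar> < M"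
      using \<delta>[of x] that by (simp_all add: dist_commute)
    have "chart_inv c x \<in> fst c" using x chart_facts[OF chart] by auto
    then have "?B x v v \<le> M * (real DIM(real ^ 'n) * norm v)\<^sup>2"
      using x by (intro form_le_norm bilinear_metric_form) (auto intro: less_imp_le)
    then have "sqrt (?B x v v) \<le> sqrt (M * (real DIM(real ^ 'n) * norm v)\<^sup>2)"
      by (rule real_sqrt_le_mono)
    then show ?thesis by (simp add: tangent_norm_coord_vector C_def real_sqrt_mult abs_mult)
  qed
  moreover have "C > 0" using \<open>M > 0\<close> by (simp add: C_def)
  moreover have "ball ?x \<delta> \<subseteq> chart_img c" using \<delta> by (auto simp: dist_commute)
  ultimately show ?thesis using \<open>\<delta> > 0\<close> by blast
qed

section \<open>Riemannian gradients in a chart\<close>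

text \<open>
  This is the vector of partial derivatives in the chart, not the coordinate vector of the
  Riemannian gradient. The latter differs from it by the inverse of the metric tensor, an
  isomorphism that dependence relations and ranks do not see.
\<close>

definition chart_grad :: "('a \<Rightarrow> real) \<Rightarrow> 'a \<Rightarrow> real ^ 'n" where
  "chart_grad f q = (\<Sum>b\<in>Basis. frechet_derivative (f \<circ> chart_inv c) (at (snd c q)) b *\<^sub>R b)"

lemma coord_vector_chart_grad:
  assumes q: "q \<in> fst c" and f: "differentiable_at_pt A q f"
  shows "coord_vector A c q v f = chart_grad f q \<bullet> v"
  using f q unfolding chart_grad_def
  by (subst linear_functional_gradient)
     (auto simp: coord_vector_def differentiable_at_pt_iff linear_frechet_derivative)

lemma rgrad_eqI:
  assumes q: "q \<in> fst c" and f: "differentiable_at_pt A q f"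
    and u: "\<And>v. metric_form q u v = chart_grad f q \<bullet> v"
  shows "rgrad A G f q = coord_vector A c q u"
  unfolding rgrad_def
proof (rule the_equality)
  show "coord_vector A c q u \<in> tangent_space A q \<and>
     (\<forall>V\<in>tangent_space A q. G q (coord_vector A c q u) V = V f)"
    using u by (auto simp: tangent_space_eq[OF q] metric_form_def coord_vector_chart_grad[OF q f])
next
  fix X assume X: "X \<in> tangent_space A q \<and> (\<forall>V\<in>tangent_space A q. G q X V = V f)"
  then obtain w where w: "X = coord_vector A c q w" by (auto simp: tangent_space_eq[OF q])
  have "metric_form q w v = metric_form q u v" for v
    using X u by (simp add: w tangent_space_eq[OF q] metric_form_def coord_vector_chart_grad[OF q f])
  then have "metric_form q (w - u) (w - u) = 0"
    by (simp add: bilinear_lsub[OF bilinear_metric_form[OF q]])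
  then have "w - u = 0" using metric_form_pos[OF q, of "w - u"] by fastforce
  then show "X = coord_vector A c q u" by (simp add: w)
qed

text \<open>
  The map that sends \<open>u\<close> to the Euclidean representative of the functional \<open>metric_form q u\<close> (given
  by the matrix of the metric) is injective by definiteness, hence bijective; \<open>S\<close> is its inverse.
\<close>

lemma metric_form_riesz:
  assumes q: "q \<in> fst c"
  obtains S where "linear S" "inj S" "\<And>w v. metric_form q (S w) v = w \<bullet> v"
proof -
  define T where "T u = (\<Sum>b\<in>Basis. metric_form q u b *\<^sub>R b)" for u
  note bil = bilinear_metric_form[OF q]
  have T: "T u \<bullet> v = metric_form q u v" for u v
    unfolding T_def using bil by (intro linear_functional_gradient) (simp add: bilinear_def)
  have "linear T"
    by (rule linearI)
       (simp_all add: T_def bilinear_ladd[OF bil] bilinear_lmul[OF bil] scaleR_left_distrib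
         sum.distrib scaleR_sum_right)
  moreover have "inj T"
  proof (rule linear_injective_0[THEN iffD2, OF \<open>linear T\<close>, rule_format])
    fix u assume "T u = 0"
    then have "metric_form q u u = 0" using T[of u u] by simp
    then show "u = 0" using metric_form_pos[OF q, of u] by fastforce
  qed
  ultimately obtain S where S: "linear S" "\<forall>x. S (T x) = x" "\<forall>x. T (S x) = x"
    using linear_injective_isomorphism by blast
  show thesis
  proof
    show "linear S" by (rule S(1))
    show "inj S" using S(3) by (metis injI)
    show "metric_form q (S w) v = w \<bullet> v" for w v using S(3) by (simp add: T[symmetric])
  qed
qed

text \<open>
  At each point of the chart, one injective linear map takes coordinate gradients to Riemannian
  gradients, for all functions at once. It is the reason that every linear-algebraic condition on
  Riemannian gradients is equivalent to the same condition on coordinate gradients.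
\<close>

lemma rgrad_linear_image:
  assumes q: "q \<in> fst c"
  obtains \<Phi> where "linear \<Phi>" "inj \<Phi>"
    "\<And>f. differentiable_at_pt A q f \<Longrightarrow> rgrad A G f q = \<Phi> (chart_grad f q)"
proof -
  obtain S where S: "linear S" "inj S" "\<And>w v. metric_form q (S w) v = w \<bullet> v"
    using metric_form_riesz[OF q] by blast
  show thesis
  proof
    show "linear (coord_vector A c q \<circ> S)"
      using S(1) linear_coord_vector[OF q] by (rule linear_compose)
    show "inj (coord_vector A c q \<circ> S)" using inj_coord_vector[OF q] S(2) by (rule inj_compose)
    show "rgrad A G f q = (coord_vector A c q \<circ> S) (chart_grad f q)"
      if "differentiable_at_pt A q f" for f
      using rgrad_eqI[OF q that, of "S (chart_grad f q)"] S by simp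
  qed
qed

text \<open>
  An upper bound for the metric bounds the dual metric from below: the derivative of \<open>f\<close> along its
  coordinate gradient \<open>u\<close> is the square of the norm of \<open>u\<close>, and by the Cauchy-Schwarz inequality
  it is at most the product of the Riemannian norms of \<open>u\<close> and of the Riemannian gradient.
\<close>

lemma norm_chart_grad_le:
  assumes q: "q \<in> fst c" and f: "differentiable_at_pt A q f"
    and C: "\<And>v. tangent_norm G q (coord_vector A c q v) \<le> C * norm v"
  shows "norm (chart_grad f q) \<le> C * tangent_norm G q (rgrad A G f q)"
proof (cases "chart_grad f q = 0")
  case True
  obtain \<Phi> where \<Phi>: "linear \<Phi>" "rgrad A G f q = \<Phi> (chart_grad f q)"
    using rgrad_linear_image[OF q] f by metis
  have "rgrad A G f q = coord_vector A c q 0"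
    using True \<Phi> by (simp add: linear_0 linear_0[OF linear_coord_vector[OF q]])
  then show ?thesis
    using True by (simp add: tangent_norm_coord_vector bilinear_lzero[OF bilinear_metric_form[OF q]])
next
  case False
  let ?g = "chart_grad f q"
  obtain S where S: "\<And>w v. metric_form q (S w) v = w \<bullet> v"
    using metric_form_riesz[OF q] by metis
  let ?u = "S ?g"
  have rg: "rgrad A G f q = coord_vector A c q ?u" by (rule rgrad_eqI[OF q f S])
  have "norm ?g * norm ?g = metric_form q ?u ?g"
    by (simp add: S power2_norm_eq_inner[symmetric] power2_eq_square)
  also have "\<dots> \<le> sqrt (metric_form q ?u ?u) * sqrt (metric_form q ?g ?g)"
    using form_cauchy_schwarz[OF bilinear_metric_form[OF q] metric_form_sym[OF q]
        metric_form_pos[OF q], of ?u ?g] by linarith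
  also have "\<dots> = tangent_norm G q (rgrad A G f q) * tangent_norm G q (coord_vector A c q ?g)"
    by (simp add: rg tangent_norm_coord_vector)
  also have "\<dots> \<le> tangent_norm G q (rgrad A G f q) * (C * norm ?g)"
  proof (rule mult_left_mono[OF C])
    show "0 \<le> tangent_norm G q (rgrad A G f q)"
      using metric_form_pos[OF q, of ?u] bilinear_lzero[OF bilinear_metric_form[OF q]]
      by (cases "?u = 0") (auto simp: rg tangent_norm_coord_vector less_imp_le)
  qed
  finally have "norm ?g * norm ?g \<le> (C * tangent_norm G q (rgrad A G f q)) * norm ?g"
    by (simp add: mult_ac)
  then show ?thesis using False by simp
qed

lemma lin_dep_rgrad_iff:
  assumes q: "q \<in> fst c" and h: "\<And>i. i \<in> I \<Longrightarrow> differentiable_at_pt A q (h i)"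
    and g: "\<And>j. j \<in> J \<Longrightarrow> differentiable_at_pt A q (g j)"
  shows "lin_dep I (\<lambda>i. rgrad A G (h i) q) J (\<lambda>j. rgrad A G (g j) q) \<longleftrightarrow>
      lin_dep I (\<lambda>i. chart_grad (h i) q) J (\<lambda>j. chart_grad (g j) q)"
    and "pos_lin_dep I (\<lambda>i. rgrad A G (h i) q) J (\<lambda>j. rgrad A G (g j) q) \<longleftrightarrow>
      pos_lin_dep I (\<lambda>i. chart_grad (h i) q) J (\<lambda>j. chart_grad (g j) q)"
proof -
  obtain \<Phi> where \<Phi>: "linear \<Phi>" "inj \<Phi>"
    and rg: "\<And>f. differentiable_at_pt A q f \<Longrightarrow> rgrad A G f q = \<Phi> (chart_grad f q)"
    using rgrad_linear_image[OF q] by metis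
  show "lin_dep I (\<lambda>i. rgrad A G (h i) q) J (\<lambda>j. rgrad A G (g j) q) \<longleftrightarrow>
      lin_dep I (\<lambda>i. chart_grad (h i) q) J (\<lambda>j. chart_grad (g j) q)"
    by (rule lin_dep_linear_image[OF \<Phi>]) (simp_all add: rg h g)
  show "pos_lin_dep I (\<lambda>i. rgrad A G (h i) q) J (\<lambda>j. rgrad A G (g j) q) \<longleftrightarrow>
      pos_lin_dep I (\<lambda>i. chart_grad (h i) q) J (\<lambda>j. chart_grad (g j) q)"
    by (rule lin_dep_linear_image[OF \<Phi>]) (simp_all add: rg h g)
qed

lemma chart_grad_in_span:
  fixes w :: "'j \<Rightarrow> real ^ 'n"
  assumes q: "q \<in> fst c" and h: "\<And>i. i \<in> I \<Longrightarrow> differentiable_at_pt A q (h i)"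
    and I: "finite I" "K \<subseteq> I" and ind: "\<not> lin_dep K (\<lambda>i. chart_grad (h i) q) {} w"
    and rank: "dim ((\<lambda>i. rgrad A G (h i) q) ` I) = card K" and i: "i \<in> I"
  shows "chart_grad (h i) q \<in> span ((\<lambda>i. chart_grad (h i) q) ` K)"
proof -
  obtain \<Phi> where \<Phi>: "linear \<Phi>" "inj \<Phi>"
    and rg: "\<And>f. differentiable_at_pt A q f \<Longrightarrow> rgrad A G f q = \<Phi> (chart_grad f q)"
    using rgrad_linear_image[OF q] by metis
  have "lin_dep K (\<lambda>i. rgrad A G (h i) q) {} (\<Phi> \<circ> w) \<longleftrightarrow> lin_dep K (\<lambda>i. chart_grad (h i) q) {} w"
    using h I by (intro lin_dep_linear_image[OF \<Phi>]) (auto simp: rg)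
  then have "rgrad A G (h i) q \<in> span ((\<lambda>i. rgrad A G (h i) q) ` K)"
    using subfamily_spans[OF I _ rank i] ind by blast
  moreover have "(\<lambda>i. rgrad A G (h i) q) ` K = \<Phi> ` (\<lambda>i. chart_grad (h i) q) ` K"
    unfolding image_image using h I by (intro image_cong) (auto simp: rg)
  ultimately have "\<Phi> (chart_grad (h i) q) \<in> \<Phi> ` span ((\<lambda>i. chart_grad (h i) q) ` K)"
    using rg[OF h[OF i]] by (simp add: linear_span_image[OF \<Phi>(1)])
  then show ?thesis using inj_image_mem_iff[OF \<Phi>(2)] by blast
qed

lemma C1_fun_differentiable:
  assumes "C1_fun A f" and q: "q \<in> fst c"
  shows "differentiable_at_pt A q f"
  using assms chart unfolding C1_fun_def differentiable_at_pt_iff[OF q] by auto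

lemma tendsto_chart_grad:
  assumes f: "C1_fun A f" and p: "p \<in> fst c" and P: "P \<longlonglongrightarrow> p"
  shows "(\<lambda>k. chart_grad f (P k)) \<longlonglongrightarrow> chart_grad f p"
proof -
  have x: "(\<lambda>k. snd c (P k)) \<longlonglongrightarrow> snd c p"
    using chart_facts(1,3)[OF chart] p P
    by (intro isCont_tendsto_compose[OF _ P]) (auto simp: continuous_on_eq_continuous_at)
  have "(\<lambda>k. frechet_derivative (f \<circ> chart_inv c) (at (snd c (P k))) b) \<longlonglongrightarrow>
      frechet_derivative (f \<circ> chart_inv c) (at (snd c p)) b" for b
  proof (rule isCont_tendsto_compose[OF _ x])
    have "continuous_on (chart_img c) (\<lambda>x. frechet_derivative (f \<circ> chart_inv c) (at x) b)"
      using f chart unfolding C1_fun_def by auto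
    then show "isCont (\<lambda>x. frechet_derivative (f \<circ> chart_inv c) (at x) b) (snd c p)"
      using chart_facts(2)[OF chart] p by (auto simp: continuous_on_eq_continuous_at)
  qed
  then show ?thesis unfolding chart_grad_def by (intro tendsto_intros)
qed

lemma chart_grad_lagrangian:
  assumes q: "q \<in> fst c" and f: "differentiable_at_pt A q f"
    and h: "\<forall>i\<in>{1..s}. differentiable_at_pt A q (h i)"
    and g: "\<forall>j\<in>{1..m}. differentiable_at_pt A q (g j)"
  shows "differentiable_at_pt A q (\<lambda>y. lagrangian f s h m g y lam \<mu>)"
    and "chart_grad (\<lambda>y. lagrangian f s h m g y lam \<mu>) q = chart_grad f q
      + (\<Sum>i\<in>{1..s}. lam i *\<^sub>R chart_grad (h i) q) + (\<Sum>j\<in>{1..m}. \<mu> j *\<^sub>R chart_grad (g j) q)"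
proof -
  let ?L = "\<lambda>y. lagrangian f s h m g y lam \<mu>"
  let ?D = "\<lambda>f. frechet_derivative (f \<circ> chart_inv c) (at (snd c q))"
  have D: "((\<lambda>x. f (chart_inv c x)) has_derivative ?D f) (at (snd c q))"
    if "differentiable_at_pt A q f" for f
    using that by (simp add: differentiable_at_pt_iff[OF q] frechet_derivative_works comp_def)
  have L: "((?L \<circ> chart_inv c) has_derivative
      (\<lambda>v. ?D f v + (\<Sum>i\<in>{1..s}. lam i * ?D (h i) v) + (\<Sum>j\<in>{1..m}. \<mu> j * ?D (g j) v)))
      (at (snd c q))"
    unfolding lagrangian_def comp_def
    using D[OF f] D h g
    by (intro has_derivative_add has_derivative_sum has_derivative_mult_right) (auto simp: comp_def)
  then show "differentiable_at_pt A q ?L"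
    unfolding differentiable_at_pt_iff[OF q] differentiable_def by blast
  have "?D ?L b *\<^sub>R b = ?D f b *\<^sub>R b + (\<Sum>i\<in>{1..s}. lam i *\<^sub>R ?D (h i) b *\<^sub>R b)
      + (\<Sum>j\<in>{1..m}. \<mu> j *\<^sub>R ?D (g j) b *\<^sub>R b)" for b
    unfolding frechet_derivative_at[OF L, symmetric]
    by (simp add: scaleR_left_distrib scaleR_sum_left)
  then show "chart_grad ?L q = chart_grad f q
      + (\<Sum>i\<in>{1..s}. lam i *\<^sub>R chart_grad (h i) q) + (\<Sum>j\<in>{1..m}. \<mu> j *\<^sub>R chart_grad (g j) q)"
    unfolding chart_grad_def scaleR_sum_right
    by (simp add: sum.distrib sum.swap[of _ Basis])
qed

section \<open>Riemannian balls are neighbourhoods\<close>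

text \<open>
  In the chart \<open>c\<close> the curve is affine; in the other charts of the atlas its velocity is the image
  of \<open>y - x\<close> under the derivative of the transition map, which varies continuously.
\<close>

lemma segment_curve:
  assumes seg: "closed_segment x y \<subseteq> chart_img c"
  defines "\<gamma> \<equiv> \<lambda>t. chart_inv c (x + t *\<^sub>R (y - x))"
  shows "piecewise_C1_curve A \<gamma>"
    and "t \<in> {0..1} \<Longrightarrow> velocity A \<gamma> t = coord_vector A c (\<gamma> t) (y - x)"
proof -
  let ?l = "\<lambda>t. x + t *\<^sub>R (y - x)"
  have img: "?l t \<in> chart_img c" if "t \<in> {0..1}" for t
  proof -
    have "?l t = (1 - t) *\<^sub>R x + t *\<^sub>R y" by (simp add: algebra_simps)
    then have "?l t \<in> closed_segment x y" using that by (auto simp: in_segment)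
    then show ?thesis using seg by blast
  qed
  have dom: "\<gamma> t \<in> fst c" and coord: "snd c (\<gamma> t) = ?l t" if "t \<in> {0..1}" for t
    using img[OF that] chart_facts(5)[OF chart] unfolding \<gamma>_def by (auto simp: f_inv_into_f)
  have l: "(?l has_derivative (\<lambda>h. h *\<^sub>R (y - x))) (at t within {0..1})" for t
    by (auto intro!: derivative_eq_intros)
  have chain: "((F \<circ> ?l) has_vector_derivative D (y - x)) (at t within {0..1})"
    if "(F has_derivative D) (at (?l t))" for F :: "real ^ 'n \<Rightarrow> 'z::real_normed_vector" and D t
  proof -
    have "linear D" using that by (rule has_derivative_linear)
    with diff_chain_within[OF l, of F D t] that show ?thesis
      unfolding has_vector_derivative_def
      by (simp add: has_derivative_at_withinI o_def linear_scale)
  qed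
  have "C1_curve_on A \<gamma> 0 1"
    unfolding C1_curve_on_def
  proof (intro conjI ballI)
    have "continuous_on {0..1} (chart_inv c \<circ> ?l)"
      using img by (intro continuous_on_compose continuous_intros
          continuous_on_subset[OF chart_facts(4)[OF chart]]) auto
    then show "continuous_on {0..1} \<gamma>" by (simp add: \<gamma>_def o_def)
  next
    fix c' assume c': "c' \<in> A"
    let ?I = "{0..1} \<inter> \<gamma> -` fst c'"
    let ?T = "snd c' \<circ> chart_inv c"
    let ?D = "\<lambda>t. frechet_derivative ?T (at (?l t)) (y - x)"
    have ov: "?l t \<in> snd c ` (fst c \<inter> fst c')" if "t \<in> ?I" for t
      using dom[of t] coord[of t] that by force
    have "continuous_on ?I ((\<lambda>z. frechet_derivative ?T (at z) (y - x)) \<circ> ?l)"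
      using ov by (intro continuous_on_compose continuous_intros
          continuous_on_subset[OF transition(2)[OF chart c']]) auto
    moreover have "((snd c' \<circ> \<gamma>) has_vector_derivative ?D t) (at t within {0..1})"
      if "t \<in> ?I" for t
      using chain[OF transition(1)[OF chart c' ov[OF that]]] by (simp add: \<gamma>_def o_def)
    ultimately show "\<exists>D. continuous_on ?I D \<and>
        (\<forall>t\<in>?I. ((snd c' \<circ> \<gamma>) has_vector_derivative D t) (at t within {0..1}))"
      by (intro exI[of _ ?D]) (simp add: o_def)
  qed
  then show "piecewise_C1_curve A \<gamma>"
    unfolding piecewise_C1_curve_def by (intro exI[of _ "{0, 1}"]) auto
  assume t: "t \<in> {0..1}"
  show "velocity A \<gamma> t = coord_vector A c (\<gamma> t) (y - x)"
  proof
    fix f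
    show "velocity A \<gamma> t f = coord_vector A c (\<gamma> t) (y - x) f"
    proof (cases "differentiable_at_pt A (\<gamma> t) f")
      case True
      then have "((f \<circ> chart_inv c) has_derivative
          frechet_derivative (f \<circ> chart_inv c) (at (?l t))) (at (?l t))"
        using dom coord t by (simp add: differentiable_at_pt_iff frechet_derivative_works)
      from chain[OF this] have "((f \<circ> \<gamma>) has_vector_derivative
          frechet_derivative (f \<circ> chart_inv c) (at (?l t)) (y - x)) (at t within {0..1})"
        by (simp add: \<gamma>_def o_def)
      then show ?thesis
        using True t by (simp add: velocity_def coord_vector_def coord
            vector_derivative_within_closed_interval)
    qed (simp add: velocity_def coord_vector_def)
  qed
qed

text \<open>
  The straight segment in the chart is a competitor in the infimum that defines the Riemannian
  distance, so a bound for the metric along it bounds the distance.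
\<close>

lemma rdist_le_segment:
  assumes seg: "closed_segment (snd c p) (snd c q) \<subseteq> chart_img c" and pq: "p \<in> fst c" "q \<in> fst c"
    and C: "\<And>x v. x \<in> closed_segment (snd c p) (snd c q) \<Longrightarrow>
      tangent_norm G (chart_inv c x) (coord_vector A c (chart_inv c x) v) \<le> C * norm v"
  shows "rdist A G p q \<le> ennreal (C * dist (snd c p) (snd c q))"
proof -
  let ?x = "snd c p" and ?y = "snd c q"
  define \<gamma> where "\<gamma> t = chart_inv c (?x + t *\<^sub>R (?y - ?x))" for t
  note curve = segment_curve[OF seg, folded \<gamma>_def]
  have "tangent_norm G (\<gamma> t) (velocity A \<gamma> t) \<le> C * dist ?x ?y" if t: "t \<in> {0..1}" for t
  proof -
    have "?x + t *\<^sub>R (?y - ?x) = (1 - t) *\<^sub>R ?x + t *\<^sub>R ?y" by (simp add: algebra_simps)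
    then have "?x + t *\<^sub>R (?y - ?x) \<in> closed_segment ?x ?y" using t by (auto simp: in_segment)
    from C[OF this, of "?y - ?x"] show ?thesis
      unfolding curve(2)[OF t] by (simp add: \<gamma>_def dist_norm norm_minus_commute)
  qed
  then have "curve_length A G \<gamma> \<le>
      (\<integral>\<^sup>+t. ennreal (C * dist ?x ?y) * indicator {0..1::real} t \<partial>lborel)"
    unfolding curve_length_def
    by (intro nn_integral_mono) (auto simp: indicator_def intro!: ennreal_leI)
  also have "\<dots> = ennreal (C * dist ?x ?y)"
    by (subst nn_integral_cmult_indicator) auto
  finally have "curve_length A G \<gamma> \<le> ennreal (C * dist ?x ?y)" .
  moreover have "\<gamma> 0 = p" "\<gamma> 1 = q"
    using chart_facts(5)[OF chart] pq by (simp_all add: \<gamma>_def)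
  ultimately show ?thesis
    unfolding rdist_def using curve(1) by (intro INF_lower2[of \<gamma>]) auto
qed

lemma eventually_in_rball:
  assumes p: "p \<in> fst c" and \<epsilon>: "\<epsilon> > 0"
  shows "\<forall>\<^sub>F q in nhds p. q \<in> rball A G p \<epsilon>"
proof -
  obtain C \<delta> where C: "C > 0" and \<delta>: "\<delta> > 0" "ball (snd c p) \<delta> \<subseteq> chart_img c"
    and le: "\<And>x v. x \<in> ball (snd c p) \<delta> \<Longrightarrow>
      tangent_norm G (chart_inv c x) (coord_vector A c (chart_inv c x) v) \<le> C * norm v"
    using tangent_norm_le[OF p] by blast
  define \<rho> where "\<rho> = min \<delta> (\<epsilon> / C)"
  have \<rho>: "\<rho> > 0" using C \<delta> \<epsilon> by (simp add: \<rho>_def)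
  have "isCont (snd c) p"
    using chart_facts(1,3)[OF chart] p by (auto simp: continuous_on_eq_continuous_at)
  then have "(snd c \<longlongrightarrow> snd c p) (nhds p)"
    by (simp add: isCont_def tendsto_at_iff_tendsto_nhds)
  then have "\<forall>\<^sub>F q in nhds p. dist (snd c q) (snd c p) < \<rho>" using \<rho> by (rule tendstoD)
  moreover have "\<forall>\<^sub>F q in nhds p. q \<in> fst c"
    using p chart_facts(1)[OF chart] by (intro eventually_nhds_in_open) auto
  ultimately show ?thesis
  proof eventually_elim
    case (elim q)
    have "closed_segment (snd c p) (snd c q) \<subseteq> ball (snd c p) \<delta>"
      using elim \<delta> by (intro closed_segment_subset) (auto simp: \<rho>_def dist_commute)
    then have "rdist A G p q \<le> ennreal (C * dist (snd c p) (snd c q))"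
      using \<delta> p elim le by (intro rdist_le_segment) auto
    also have "\<dots> < ennreal \<epsilon>"
      using elim C \<epsilon> by (intro ennreal_lessI) (auto simp: \<rho>_def dist_commute field_simps)
    finally show ?case by (simp add: rball_def)
  qed
qed

end

section \<open>Approximate KKT points that satisfy RCPLD are KKT points\<close>

theorem theorem3p2:
  fixes A :: "('a::{t2_space, second_countable_topology}, 'n::finite) chart set"
    and G :: "'a \<Rightarrow> (('a \<Rightarrow> real) \<Rightarrow> real) \<Rightarrow> (('a \<Rightarrow> real) \<Rightarrow> real) \<Rightarrow> real"
    and f :: "'a \<Rightarrow> real"
    and h g :: "nat \<Rightarrow> 'a \<Rightarrow> real"
    and s m :: nat
    and p :: 'a
  assumes "smooth_atlas A"
    and "riemannian_metric A G"
    and "riemannian_complete A G"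
    and "C1_fun A f"
    and "\<forall>i\<in>{1..s}. C1_fun A (h i)"
    and "\<forall>j\<in>{1..m}. C1_fun A (g j)"
    and "p \<in> feasible s h m g"
    and "RCPLD A G s h m g p"
    and "AKKT_point A G f s h m g p"
  shows "KKT_point A G f s h m g p"
proof -
  note C1 = assms(4-6)
  obtain c where c: "c \<in> A" "p \<in> fst c"
    using assms(1) unfolding smooth_atlas_def by blast
  interpret riemannian_chart A G c
    using assms(1,2) c(1) by unfold_locales
  note p = c(2)
  define Act where "Act = active m g p"
  have Act: "Act \<subseteq> {1..m}" "finite Act" by (auto simp: Act_def active_def)
  have diff_f: "differentiable_at_pt A q f"
    and diff_h: "\<And>i. i \<in> {1..s} \<Longrightarrow> differentiable_at_pt A q (h i)"
    and diff_g: "\<And>j. j \<in> {1..m} \<Longrightarrow> differentiable_at_pt A q (g j)" if "q \<in> fst c" for q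
    using C1 C1_fun_differentiable[OF _ that] by blast+
  obtain \<epsilon> r K where \<epsilon>: "\<epsilon> > 0"
    and rank: "\<forall>q\<in>rball A G p \<epsilon>. dim ((\<lambda>i. rgrad A G (h i) q) ` {1..s}) = r"
    and K: "K \<subseteq> {1..s}"
    and basis: "family_basis_of K (\<lambda>i. rgrad A G (h i) p) (span ((\<lambda>i. rgrad A G (h i) p) ` {1..s}))"
    and cpld: "\<forall>J\<subseteq>Act. pos_lin_dep K (\<lambda>i. rgrad A G (h i) p) J (\<lambda>j. rgrad A G (g j) p) \<longrightarrow>
      (\<forall>q\<in>rball A G p \<epsilon>. lin_dep K (\<lambda>i. rgrad A G (h i) q) J (\<lambda>j. rgrad A G (g j) q))"
    using assms(8) unfolding RCPLD_def Act_def[symmetric] by (elim conjE exE) (rule that)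
  obtain P lam \<mu> where nonneg: "\<forall>k. \<forall>j\<in>{1..m}. 0 \<le> \<mu> k j" and P: "P \<longlonglongrightarrow> p"
    and small: "(\<lambda>k. tangent_norm G (P k)
      (rgrad A G (\<lambda>q. lagrangian f s h m g q (lam k) (\<mu> k)) (P k))) \<longlonglongrightarrow> 0"
    and inactive: "\<forall>\<^sub>F k in sequentially. \<forall>j\<in>{1..m} - Act. \<mu> k j = 0"
    using assms(9) unfolding AKKT_point_def Act_def[symmetric] by (elim conjE exE) (rule that)
  define R where "R k = chart_grad f (P k) + (\<Sum>i\<in>{1..s}. lam k i *\<^sub>R chart_grad (h i) (P k))
    + (\<Sum>j\<in>Act. \<mu> k j *\<^sub>R chart_grad (g j) (P k))" for k

  have ev_dom: "\<forall>\<^sub>F k in sequentially. P k \<in> fst c"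
    using p chart_facts(1)[OF chart] by (intro topological_tendstoD[OF P])
  have ev_ball: "\<forall>\<^sub>F k in sequentially. P k \<in> rball A G p \<epsilon>"
    by (rule eventually_compose_filterlim[OF eventually_in_rball[OF p \<epsilon>] P])

  have ind_rgrad: "\<not> lin_dep K (\<lambda>i. rgrad A G (h i) p) {} (\<lambda>j. rgrad A G (g j) p)"
    using basis K finite_subset[OF K]
    by (subst not_lin_dep_iff_independent) (auto simp: family_basis_of_def)
  then have ind: "\<not> lin_dep K (\<lambda>i. chart_grad (h i) p) {} (\<lambda>j. chart_grad (g j) p)"
    using lin_dep_rgrad_iff(1)[OF p, of K h "{}" g] diff_h[OF p] K by blast

  have r: "r = card K"
  proof -
    have "p \<in> rball A G p \<epsilon>" using eventually_in_rball[OF p \<epsilon>] by (rule eventually_nhds_x_imp_x)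
    then have "r = dim ((\<lambda>i. rgrad A G (h i) p) ` {1..s})" using rank by simp
    also have "\<dots> = card ((\<lambda>i. rgrad A G (h i) p) ` K)"
      using basis by (intro dim_eq_card) (auto simp: family_basis_of_def)
    also have "\<dots> = card K" using basis by (intro card_image) (simp add: family_basis_of_def)
    finally show ?thesis .
  qed

  \<comment> \<open>\<open>K\<close> has as many members as the rank at \<open>p\<close>, hence as the rank at all nearby points.\<close>
  have spanning: "\<forall>\<^sub>F k in sequentially. \<forall>i\<in>{1..s}.
      chart_grad (h i) (P k) \<in> span ((\<lambda>i. chart_grad (h i) (P k)) ` K)"
  proof -
    have "\<forall>\<^sub>F k in sequentially. \<not> lin_dep K (\<lambda>i. chart_grad (h i) (P k)) {} (\<lambda>j. chart_grad (g j) (P k))"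
      using K C1 finite_subset[OF K]
      by (intro eventually_lin_indep[OF _ _ ind] ballI tendsto_chart_grad[OF _ p P]) auto
    with ev_dom ev_ball show ?thesis
    proof eventually_elim
      case (elim k)
      show ?case
        using elim K rank r diff_h
        by (intro ballI chart_grad_in_span[where I = "{1..s}"]) auto
    qed
  qed

  have cpld_chart: "\<forall>J\<subseteq>Act. pos_lin_dep K (\<lambda>i. chart_grad (h i) p) J (\<lambda>j. chart_grad (g j) p) \<longrightarrow>
     (\<forall>\<^sub>F k in sequentially. lin_dep K (\<lambda>i. chart_grad (h i) (P k)) J (\<lambda>j. chart_grad (g j) (P k)))"
  proof (intro allI impI)
    fix J assume J: "J \<subseteq> Act"
      and dep: "pos_lin_dep K (\<lambda>i. chart_grad (h i) p) J (\<lambda>j. chart_grad (g j) p)"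
    have J': "J \<subseteq> {1..m}" using J Act by blast
    have "pos_lin_dep K (\<lambda>i. rgrad A G (h i) p) J (\<lambda>j. rgrad A G (g j) p)"
      using dep lin_dep_rgrad_iff(2)[OF p, of K h J g] diff_h[OF p] diff_g[OF p] K J' by blast
    note dep_near = cpld[rule_format, OF J this]
    from ev_dom ev_ball
    show "\<forall>\<^sub>F k in sequentially. lin_dep K (\<lambda>i. chart_grad (h i) (P k)) J (\<lambda>j. chart_grad (g j) (P k))"
    proof eventually_elim
      case (elim k)
      then show ?case
        using dep_near lin_dep_rgrad_iff(1)[of "P k" K h J g] diff_h diff_g K J' by blast
    qed
  qed

  \<comment> \<open>The metric bound is uniform near \<open>p\<close>, so the decay of the Riemannian norms carries over to coordinates.\<close>
  have R: "R \<longlonglongrightarrow> 0"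
  proof -
    obtain C \<delta> where \<delta>: "\<delta> > 0" and le: "\<And>x v. x \<in> ball (snd c p) \<delta> \<Longrightarrow>
        tangent_norm G (chart_inv c x) (coord_vector A c (chart_inv c x) v) \<le> C * norm v"
      using tangent_norm_le[OF p] by blast
    have "isCont (snd c) p"
      using chart_facts(1,3)[OF chart] p by (auto simp: continuous_on_eq_continuous_at)
    then have "(\<lambda>k. snd c (P k)) \<longlonglongrightarrow> snd c p" using P by (rule isCont_tendsto_compose)
    then have "\<forall>\<^sub>F k in sequentially. dist (snd c (P k)) (snd c p) < \<delta>" using \<delta> by (rule tendstoD)
    with ev_dom inactive have "\<forall>\<^sub>F k in sequentially. norm (R k) \<le> C * tangent_norm G (P k)
        (rgrad A G (\<lambda>q. lagrangian f s h m g q (lam k) (\<mu> k)) (P k))"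
    proof eventually_elim
      case (elim k)
      let ?L = "\<lambda>q. lagrangian f s h m g q (lam k) (\<mu> k)"
      have L: "differentiable_at_pt A (P k) ?L" "chart_grad ?L (P k) = chart_grad f (P k)
          + (\<Sum>i\<in>{1..s}. lam k i *\<^sub>R chart_grad (h i) (P k))
          + (\<Sum>j\<in>{1..m}. \<mu> k j *\<^sub>R chart_grad (g j) (P k))"
        using elim diff_f diff_h diff_g by (intro chart_grad_lagrangian; blast)+
      have "(\<Sum>j\<in>{1..m}. \<mu> k j *\<^sub>R chart_grad (g j) (P k)) =
          (\<Sum>j\<in>Act. \<mu> k j *\<^sub>R chart_grad (g j) (P k))"
        using elim Act by (intro sum.mono_neutral_right) auto
      then have "R k = chart_grad ?L (P k)" by (simp add: R_def L(2))
      moreover have "tangent_norm G (P k) (coord_vector A c (P k) v) \<le> C * norm v" for v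
        using le[of "snd c (P k)" v] elim chart_facts(5)[OF chart, of "P k"]
        by (simp add: dist_commute)
      ultimately show ?case using norm_chart_grad_le[OF _ L(1)] elim by simp
    qed
    moreover have "(\<lambda>k. C * tangent_norm G (P k)
        (rgrad A G (\<lambda>q. lagrangian f s h m g q (lam k) (\<mu> k)) (P k))) \<longlonglongrightarrow> 0"
      using tendsto_mult_right_zero[OF small] .
    ultimately show ?thesis by (rule Lim_null_comparison)
  qed

  have "\<exists>lam \<mu>. (\<forall>j\<in>Act. 0 \<le> \<mu> j) \<and> chart_grad f p
      + (\<Sum>i\<in>{1..s}. lam i *\<^sub>R chart_grad (h i) p) + (\<Sum>j\<in>Act. \<mu> j *\<^sub>R chart_grad (g j) p) = 0"
  proof (rule multipliers_in_the_limit[OF _ K Act(2) _ _ _ ind spanning cpld_chart])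
    show "(\<lambda>k. chart_grad f (P k)) \<longlonglongrightarrow> chart_grad f p"
      "\<forall>i\<in>{1..s}. (\<lambda>k. chart_grad (h i) (P k)) \<longlonglongrightarrow> chart_grad (h i) p"
      "\<forall>j\<in>Act. (\<lambda>k. chart_grad (g j) (P k)) \<longlonglongrightarrow> chart_grad (g j) p"
      using C1 Act by (auto intro!: tendsto_chart_grad[OF _ p P])
    show "\<forall>k. \<forall>j\<in>Act. 0 \<le> \<mu> k j" using nonneg Act by blast
    show "(\<lambda>k. chart_grad f (P k) + (\<Sum>i\<in>{1..s}. lam k i *\<^sub>R chart_grad (h i) (P k))
        + (\<Sum>j\<in>Act. \<mu> k j *\<^sub>R chart_grad (g j) (P k))) \<longlonglongrightarrow> 0"
      using R unfolding R_def .
  qed simp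
  then obtain lam' \<mu>0 where pos: "\<forall>j\<in>Act. 0 \<le> \<mu>0 j" and zero: "chart_grad f p
      + (\<Sum>i\<in>{1..s}. lam' i *\<^sub>R chart_grad (h i) p) + (\<Sum>j\<in>Act. \<mu>0 j *\<^sub>R chart_grad (g j) p) = 0"
    by blast
  define \<mu>' where "\<mu>' j = (if j \<in> Act then \<mu>0 j else 0)" for j
  let ?L = "\<lambda>q. lagrangian f s h m g q lam' \<mu>'"
  have L: "differentiable_at_pt A p ?L" "chart_grad ?L p = chart_grad f p
      + (\<Sum>i\<in>{1..s}. lam' i *\<^sub>R chart_grad (h i) p) + (\<Sum>j\<in>{1..m}. \<mu>' j *\<^sub>R chart_grad (g j) p)"
    using p diff_f diff_h diff_g by (intro chart_grad_lagrangian; blast)+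
  have "(\<Sum>j\<in>{1..m}. \<mu>' j *\<^sub>R chart_grad (g j) p) = (\<Sum>j\<in>Act. \<mu>0 j *\<^sub>R chart_grad (g j) p)"
    using Act by (intro sum.mono_neutral_cong_right) (auto simp: \<mu>'_def)
  then have "chart_grad ?L p = 0" using zero by (simp add: L(2))
  moreover obtain \<Phi> where "linear \<Phi>" "rgrad A G ?L p = \<Phi> (chart_grad ?L p)"
    using rgrad_linear_image[OF p] L(1) by metis
  ultimately have "rgrad A G ?L p = 0" by (simp add: linear_0)
  then show ?thesis
    unfolding KKT_point_def using assms(7) pos
    by (intro conjI exI[of _ lam'] exI[of _ \<mu>']) (auto simp: \<mu>'_def Act_def)
qed

end
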